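(* Let $A,B\in B(H,H_o)$ be Parseval frame generators for a unitary representation $(G,\pi,H)$ of a discrete group $G$. (i) The following are equivalent: $B=AU$ for some unitary $U\in\pi(G)'$; $B=L_e^*W\theta_A$ for some unitary $W\in\mathscr R(G)\otimes B(H_o)$ with $WP_A=P_AW$; $P_B=P_A$. (ii) Let $U\in B(H_o)$ be unitary. Then $B=UA$ if and only if $B=L_e^*(I\otimes U)\theta_A$. If $B=UA$, then $P_B=(I\otimes U)P_A(I\otimes U^* )$. (iii) $B=AU$ for some unitary $U\in\pi(G)''$ if and only if $B=L_e^*(W\otimes I_o)\theta_A$ for some unitary $W\in\mathscr R(G)$. If $B=L_e^*(W\otimes I_o)\theta_A$ (with $W\in\mathscr R(G)$ unitary), then $P_B=(W\otimes I_o)P_A(W^*\otimes I_o)$.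
   Context: $G$ is a discrete group with identity $e$; $H,H_o$ are Hilbert spaces; $H_G:=\ell^2(G)\otimes H_o$; $I$ and $I_o$ are the identities of $\ell^2(G)$ and $H_o$; $\{\chi_g\}$ is the standard basis of $\ell^2(G)$. $\mathscr R(G)\subset B(\ell^2(G))$ is the von Neumann algebra generated by the right regular representation, and $\mathscr R(G)\otimes B(H_o)$ is the von Neumann tensor product. $\pi(G)''$ is the von Neumann algebra generated by $\{\pi_g\}_{g\in G}$ and $\pi(G)'$ its commutant. $L_g:H_o\to H_G$ is $L_gh=\chi_g\otimes h$. $A\in B(H,H_o)$ is a Parseval frame generator for $(G,\pi,H)$ if $\sum_g\pi_gA^*A\pi_{g^{-1}}=I$ in the strong operator topology (net of finite partial sums). Its analysis operator is $\theta_A:=\sum_gL_gA\pi_{g^{-1}}\in B(H,H_G)$ (strong convergence), an isometry, and its frame projection is $P_A:=\theta_A\theta_A^*$. *)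

theory Defs
  imports "HOL-Analysis.Analysis"
begin

section \<open>Complex Hilbert spaces\<close>

text \<open>The inner product is linear in the first and conjugate-linear in the second argument.\<close>

class complex_hilbert_space = banach +
  fixes scaleC :: "complex \<Rightarrow> 'a \<Rightarrow> 'a" (infixr \<open>*\<^sub>C\<close> 75)
    and cinner :: "'a \<Rightarrow> 'a \<Rightarrow> complex"
  assumes scaleC_add_right: "a *\<^sub>C (x + y) = a *\<^sub>C x + a *\<^sub>C y"
    and scaleC_add_left: "(a + b) *\<^sub>C x = a *\<^sub>C x + b *\<^sub>C x"
    and scaleC_scaleC: "a *\<^sub>C b *\<^sub>C x = (a * b) *\<^sub>C x"
    and scaleR_scaleC: "r *\<^sub>R x = complex_of_real r *\<^sub>C x"
    and cinner_commute: "cinner x y = cnj (cinner y x)"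
    and cinner_add_left: "cinner (x + y) z = cinner x z + cinner y z"
    and cinner_scaleC_left: "cinner (a *\<^sub>C x) y = a * cinner x y"
    and cinner_self_norm: "cinner x x = complex_of_real ((norm x)\<^sup>2)"

lemma scaleC_one:
  fixes x :: "'a::complex_hilbert_space"
  shows "1 *\<^sub>C x = x"
  using scaleR_scaleC[of 1 x] by simp

lemma cinner_add_right:
  fixes x y z :: "'a::complex_hilbert_space"
  shows "cinner x (y + z) = cinner x y + cinner x z"
  by (metis cinner_add_left cinner_commute complex_cnj_add)

lemma cinner_scaleC_right:
  fixes x y :: "'a::complex_hilbert_space"
  shows "cinner x (a *\<^sub>C y) = cnj a * cinner x y"
  by (metis cinner_commute cinner_scaleC_left complex_cnj_mult)

lemma norm_scaleC:
  fixes x :: "'a::complex_hilbert_space"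
  shows "norm (a *\<^sub>C x) = cmod a * norm x"
proof -
  have "cinner (a *\<^sub>C x) (a *\<^sub>C x) = (a * cnj a) * cinner x x"
    by (simp add: cinner_scaleC_left cinner_scaleC_right)
  then have "complex_of_real ((norm (a *\<^sub>C x))\<^sup>2) = complex_of_real ((cmod a)\<^sup>2 * (norm x)\<^sup>2)"
    unfolding cinner_self_norm complex_norm_square[symmetric] by simp
  then have "(norm (a *\<^sub>C x))\<^sup>2 = (cmod a * norm x)\<^sup>2"
    unfolding of_real_eq_iff power_mult_distrib .
  then show ?thesis by (simp add: power2_eq_iff_nonneg)
qed

lemma Re_cinner_le:
  fixes x y :: "'a::complex_hilbert_space"
  shows "Re (cinner x y) \<le> norm x * norm y"
proof -
  have "cinner (x + y) (x + y) = cinner x x + cinner y y + (cinner x y + cnj (cinner x y))"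
    by (simp add: cinner_add_left cinner_add_right cinner_commute[symmetric])
  then have "Re (cinner (x + y) (x + y)) = Re (cinner x x) + Re (cinner y y) + 2 * Re (cinner x y)"
    by simp
  then have "(norm (x + y))\<^sup>2 = (norm x)\<^sup>2 + (norm y)\<^sup>2 + 2 * Re (cinner x y)"
    unfolding cinner_self_norm Re_complex_of_real .
  moreover have "(norm (x + y))\<^sup>2 \<le> (norm x + norm y)\<^sup>2"
    by (simp add: norm_triangle_ineq power_mono)
  ultimately show ?thesis by (simp add: power2_sum)
qed

lemma cinner_Cauchy_Schwarz:
  fixes x y :: "'a::complex_hilbert_space"
  shows "cmod (cinner x y) \<le> norm x * norm y"
proof (cases "cinner x y = 0")
  case False
  define a where "a = cnj (sgn (cinner x y))"
  have "cmod a = 1"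
    using False by (simp add: a_def norm_sgn)
  have "cinner (a *\<^sub>C x) y = cnj (sgn (cinner x y)) * cinner x y"
    by (simp add: a_def cinner_scaleC_left)
  also have "\<dots> = cinner x y * cnj (cinner x y) / cmod (cinner x y)"
    by (simp add: sgn_eq)
  also have "\<dots> = complex_of_real (cmod (cinner x y))"
    using False by (simp add: complex_norm_square[symmetric] power2_eq_square)
  finally have "cinner (a *\<^sub>C x) y = complex_of_real (cmod (cinner x y))" .
  then have "cmod (cinner x y) = Re (cinner (a *\<^sub>C x) y)" by simp
  also have "\<dots> \<le> norm (a *\<^sub>C x) * norm y" by (rule Re_cinner_le)
  finally show ?thesis by (simp add: norm_scaleC \<open>cmod a = 1\<close>)
qed simp

instantiation complex :: complex_hilbert_space
begin
definition scaleC_complex :: "complex \<Rightarrow> complex \<Rightarrow> complex" where "scaleC_complex a x = a * x"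
definition cinner_complex :: "complex \<Rightarrow> complex \<Rightarrow> complex" where "cinner_complex x y = x * cnj y"
instance
proof
  fix a b x y z :: complex and r :: real
  show "a *\<^sub>C (x + y) = a *\<^sub>C x + a *\<^sub>C y" by (simp add: scaleC_complex_def distrib_left)
  show "(a + b) *\<^sub>C x = a *\<^sub>C x + b *\<^sub>C x" by (simp add: scaleC_complex_def distrib_right)
  show "a *\<^sub>C b *\<^sub>C x = (a * b) *\<^sub>C x" by (simp add: scaleC_complex_def)
  show "r *\<^sub>R x = complex_of_real r *\<^sub>C x" by (simp add: scaleC_complex_def scaleR_conv_of_real)
  show "cinner x y = cnj (cinner y x)" by (simp add: cinner_complex_def)
  show "cinner (x + y) z = cinner x z + cinner y z" by (simp add: cinner_complex_def distrib_right)
  show "cinner (a *\<^sub>C x) y = a * cinner x y" by (simp add: cinner_complex_def scaleC_complex_def)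
  show "cinner x x = complex_of_real ((norm x)\<^sup>2)"
    unfolding cinner_complex_def by (rule complex_norm_square[symmetric, folded of_real_power])
qed
end

section \<open>Square-summable families and Hilbert tensor products with $\ell^2$\<close>

text \<open>
  \<open>('g, 'o) ell2\<close> is the Hilbert space of square-summable families indexed by \<open>'g\<close> with values
  in \<open>'o\<close>.  Thus \<open>('g, complex) ell2\<close> is the usual $\ell^2$-space, and \<open>('g, 'o) ell2\<close> is its
  Hilbert space tensor product with \<open>'o\<close>; see \<open>cinner_tensor\<close> and \<open>tensor_total\<close> below.
\<close>

typedef (overloaded) ('g, 'o::complex_hilbert_space) ell2 =
  "{f :: 'g \<Rightarrow> 'o. (\<lambda>x. (norm (f x))\<^sup>2) summable_on UNIV}"
  morphisms coord Abs_ell2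
  by (rule exI[of _ "\<lambda>_. 0"]) simp

setup_lifting type_definition_ell2

lemma ell2I:
  fixes f :: "'g \<Rightarrow> 'o::complex_hilbert_space"
  assumes "\<And>F. finite F \<Longrightarrow> L2_set (\<lambda>x. norm (f x)) F \<le> C"
  shows "(\<lambda>x. (norm (f x))\<^sup>2) summable_on UNIV" "sqrt (\<Sum>\<^sub>\<infinity>x. (norm (f x))\<^sup>2) \<le> C"
proof -
  have "C \<ge> 0" using assms[of "{}"] by simp
  have b: "(\<Sum>x\<in>F. (norm (f x))\<^sup>2) \<le> C\<^sup>2" if "finite F" for F
    using assms[OF that] unfolding L2_set_def by (rule sqrt_le_D)
  show s: "(\<lambda>x. (norm (f x))\<^sup>2) summable_on UNIV"
    by (rule nonneg_bdd_above_summable_on) (auto intro!: bdd_aboveI[of _ "C\<^sup>2"] b)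
  have "(\<Sum>\<^sub>\<infinity>x. (norm (f x))\<^sup>2) \<le> C\<^sup>2"
    by (rule infsum_le_finite_sums[OF s]) (auto intro: b)
  then show "sqrt (\<Sum>\<^sub>\<infinity>x. (norm (f x))\<^sup>2) \<le> C"
    by (rule real_le_lsqrt[OF \<open>C \<ge> 0\<close>])
qed

lemma L2_set_le_ell2:
  fixes f :: "'g \<Rightarrow> 'o::complex_hilbert_space"
  assumes "(\<lambda>x. (norm (f x))\<^sup>2) summable_on UNIV" "finite F"
  shows "L2_set (\<lambda>x. norm (f x)) F \<le> sqrt (\<Sum>\<^sub>\<infinity>x. (norm (f x))\<^sup>2)"
  unfolding L2_set_def
  by (intro real_sqrt_le_mono finite_sum_le_infsum) (use assms in auto)

lemma L2_set_norm_add: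
  "L2_set (\<lambda>x. norm (f x + g x)) F \<le> L2_set (\<lambda>x. norm (f x)) F + L2_set (\<lambda>x. norm (g x)) F"
  by (rule order_trans[OF L2_set_mono L2_set_triangle_ineq]) (auto intro: norm_triangle_ineq)

lemma ell2_add:
  fixes f g :: "'g \<Rightarrow> 'o::complex_hilbert_space"
  assumes "(\<lambda>x. (norm (f x))\<^sup>2) summable_on UNIV" "(\<lambda>x. (norm (g x))\<^sup>2) summable_on UNIV"
  shows "(\<lambda>x. (norm (f x + g x))\<^sup>2) summable_on UNIV"
    and "sqrt (\<Sum>\<^sub>\<infinity>x. (norm (f x + g x))\<^sup>2)
      \<le> sqrt (\<Sum>\<^sub>\<infinity>x. (norm (f x))\<^sup>2) + sqrt (\<Sum>\<^sub>\<infinity>x. (norm (g x))\<^sup>2)"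
proof -
  have "L2_set (\<lambda>x. norm (f x + g x)) F
      \<le> sqrt (\<Sum>\<^sub>\<infinity>x. (norm (f x))\<^sup>2) + sqrt (\<Sum>\<^sub>\<infinity>x. (norm (g x))\<^sup>2)" if "finite F" for F
    using L2_set_norm_add[of f g F] L2_set_le_ell2[OF assms(1) that] L2_set_le_ell2[OF assms(2) that]
    by linarith
  from ell2I[OF this]
  show "(\<lambda>x. (norm (f x + g x))\<^sup>2) summable_on UNIV"
    and "sqrt (\<Sum>\<^sub>\<infinity>x. (norm (f x + g x))\<^sup>2)
      \<le> sqrt (\<Sum>\<^sub>\<infinity>x. (norm (f x))\<^sup>2) + sqrt (\<Sum>\<^sub>\<infinity>x. (norm (g x))\<^sup>2)"
    by blast+
qed

lemma ell2_scaleC: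
  fixes f :: "'g \<Rightarrow> 'o::complex_hilbert_space"
  assumes "(\<lambda>x. (norm (f x))\<^sup>2) summable_on UNIV"
  shows "(\<lambda>x. (norm (a *\<^sub>C f x))\<^sup>2) summable_on UNIV"
  using summable_on_cmult_right[OF assms, of "(cmod a)\<^sup>2"]
  by (simp add: norm_scaleC power_mult_distrib)

lemma summable_cinner:
  fixes f g :: "'g \<Rightarrow> 'o::complex_hilbert_space"
  assumes "(\<lambda>x. (norm (f x))\<^sup>2) summable_on UNIV" "(\<lambda>x. (norm (g x))\<^sup>2) summable_on UNIV"
  shows "(\<lambda>x. cinner (f x) (g x)) summable_on UNIV"
proof (rule abs_summable_summable, rule summable_on_comparison_test)
  show "(\<lambda>x. (norm (f x))\<^sup>2 + (norm (g x))\<^sup>2) summable_on UNIV"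
    by (intro summable_on_add assms)
  fix x
  have "2 * (norm (f x) * norm (g x)) \<le> (norm (f x))\<^sup>2 + (norm (g x))\<^sup>2"
    using sum_squares_bound[of "norm (f x)" "norm (g x)"] by (simp add: mult.assoc)
  then show "norm (cinner (f x) (g x)) \<le> (norm (f x))\<^sup>2 + (norm (g x))\<^sup>2"
    using cinner_Cauchy_Schwarz[of "f x" "g x"]
    by (smt (verit) mult_nonneg_nonneg norm_ge_zero)
qed auto

instantiation ell2 :: (type, complex_hilbert_space) real_normed_vector
begin

lift_definition zero_ell2 :: "('a, 'b) ell2" is "\<lambda>_. 0" by simp

lift_definition plus_ell2 :: "('a, 'b) ell2 \<Rightarrow> ('a, 'b) ell2 \<Rightarrow> ('a, 'b) ell2"
  is "\<lambda>f g x. f x + g x" by (rule ell2_add)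

lift_definition uminus_ell2 :: "('a, 'b) ell2 \<Rightarrow> ('a, 'b) ell2"
  is "\<lambda>f x. - f x" by simp

lift_definition minus_ell2 :: "('a, 'b) ell2 \<Rightarrow> ('a, 'b) ell2 \<Rightarrow> ('a, 'b) ell2"
  is "\<lambda>f g x. f x - g x"
  using ell2_add(1)[of _ "\<lambda>x. - _ x"] by simp

lift_definition scaleR_ell2 :: "real \<Rightarrow> ('a, 'b) ell2 \<Rightarrow> ('a, 'b) ell2"
  is "\<lambda>r f x. r *\<^sub>R f x"
  by (simp add: scaleR_scaleC ell2_scaleC)

lift_definition norm_ell2 :: "('a, 'b) ell2 \<Rightarrow> real"
  is "\<lambda>f. sqrt (\<Sum>\<^sub>\<infinity>x. (norm (f x))\<^sup>2)" .

definition dist_ell2 :: "('a, 'b) ell2 \<Rightarrow> ('a, 'b) ell2 \<Rightarrow> real"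
  where "dist_ell2 f g = norm (f - g)"

definition sgn_ell2 :: "('a, 'b) ell2 \<Rightarrow> ('a, 'b) ell2"
  where "sgn_ell2 f = inverse (norm f) *\<^sub>R f"

definition uniformity_ell2 :: "(('a, 'b) ell2 \<times> ('a, 'b) ell2) filter"
  where "uniformity_ell2 = (INF e\<in>{0<..}. principal {(x, y). dist x y < e})"

definition open_ell2 :: "('a, 'b) ell2 set \<Rightarrow> bool"
  where "open_ell2 U = (\<forall>x\<in>U. \<forall>\<^sub>F (x', y) in uniformity. x' = x \<longrightarrow> y \<in> U)"

instance
proof
  fix f g h :: "('a, 'b) ell2" and r s :: real
  show "f + g + h = f + (g + h)" by transfer (simp add: add.assoc)
  show "f + g = g + f" by transfer (simp add: add.commute)
  show "0 + f = f" by transfer simp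
  show "- f + f = 0" by transfer simp
  show "f - g = f + - g" by transfer simp
  show "r *\<^sub>R (f + g) = r *\<^sub>R f + r *\<^sub>R g" by transfer (simp add: scaleR_add_right)
  show "(r + s) *\<^sub>R f = r *\<^sub>R f + s *\<^sub>R f" by transfer (simp add: scaleR_add_left)
  show "r *\<^sub>R s *\<^sub>R f = (r * s) *\<^sub>R f" by transfer simp
  show "1 *\<^sub>R f = f" by transfer simp
  show "dist f g = norm (f - g)" by (rule dist_ell2_def)
  show "sgn f = inverse (norm f) *\<^sub>R f" by (rule sgn_ell2_def)
  show "(uniformity :: (('a, 'b) ell2 \<times> ('a, 'b) ell2) filter)
      = (INF e\<in>{0<..}. principal {(x, y). dist x y < e})" by (rule uniformity_ell2_def)
  show "open U = (\<forall>x\<in>U. \<forall>\<^sub>F (x', y) in uniformity. x' = x \<longrightarrow> y \<in> U)"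
    for U :: "('a, 'b) ell2 set" by (rule open_ell2_def)
  show "norm f = 0 \<longleftrightarrow> f = 0"
  proof transfer
    fix f :: "'a \<Rightarrow> 'b"
    assume s: "(\<lambda>x. (norm (f x))\<^sup>2) summable_on UNIV"
    show "sqrt (\<Sum>\<^sub>\<infinity>x. (norm (f x))\<^sup>2) = 0 \<longleftrightarrow> f = (\<lambda>_. 0)"
    proof
      assume z: "sqrt (\<Sum>\<^sub>\<infinity>x. (norm (f x))\<^sup>2) = 0"
      have "f x = 0" for x
        using L2_set_le_ell2[OF s, of "{x}"] z by simp
      then show "f = (\<lambda>_. 0)" by blast
    qed simp
  qed
  show "norm (f + g) \<le> norm f + norm g" by transfer (rule ell2_add)
  show "norm (r *\<^sub>R f) = \<bar>r\<bar> * norm f"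
    by transfer (simp add: power_mult_distrib infsum_cmult_right' real_sqrt_mult)
qed

end

lemma norm_ell2_leI: "(\<And>F. finite F \<Longrightarrow> L2_set (\<lambda>x. norm (coord f x)) F \<le> C) \<Longrightarrow> norm f \<le> C"
  unfolding norm_ell2.rep_eq by (rule ell2I(2))

lemma L2_set_coord_le: "finite F \<Longrightarrow> L2_set (\<lambda>x. norm (coord f x)) F \<le> norm f"
  unfolding norm_ell2.rep_eq using coord by (intro L2_set_le_ell2) auto

lemma norm_coord_le: "norm (coord f x) \<le> norm f"
  using L2_set_coord_le[of "{x}" f] by simp

instance ell2 :: (type, complex_hilbert_space) banach
proof
  fix X :: "nat \<Rightarrow> ('a, 'b) ell2"
  assume X: "Cauchy X"
  have "Cauchy (\<lambda>n. coord (X n) x)" for x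
  proof (rule metric_CauchyI)
    fix e :: real assume "e > 0"
    then obtain M where M: "\<And>m n. m \<ge> M \<Longrightarrow> n \<ge> M \<Longrightarrow> norm (X m - X n) < e"
      using X unfolding Cauchy_iff by blast
    then show "\<exists>M. \<forall>m\<ge>M. \<forall>n\<ge>M. dist (coord (X m) x) (coord (X n) x) < e"
      using norm_coord_le[of "X _ - X _" x]
      by (metis dist_norm minus_ell2.rep_eq order_le_less_trans)
  qed
  then have "\<exists>l. (\<lambda>n. coord (X n) x) \<longlonglongrightarrow> l" for x
    using convergent_def Cauchy_convergent by blast
  then obtain l where l: "\<And>x. (\<lambda>n. coord (X n) x) \<longlonglongrightarrow> l x" by metis
  have close: "\<exists>M. \<forall>n\<ge>M. \<forall>F. finite F \<longrightarrow> L2_set (\<lambda>x. norm (coord (X n) x - l x)) F \<le> e"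
    if "e > 0" for e
  proof -
    obtain M where M: "\<And>m n. m \<ge> M \<Longrightarrow> n \<ge> M \<Longrightarrow> norm (X m - X n) < e"
      using X \<open>e > 0\<close> unfolding Cauchy_iff by blast
    have "L2_set (\<lambda>x. norm (coord (X n) x - l x)) F \<le> e" if "n \<ge> M" "finite F" for n F
    proof (rule LIMSEQ_le_const2)
      show "(\<lambda>m. L2_set (\<lambda>x. norm (coord (X n) x - coord (X m) x)) F)
          \<longlonglongrightarrow> L2_set (\<lambda>x. norm (coord (X n) x - l x)) F"
        unfolding L2_set_def by (intro tendsto_intros l)
      show "\<exists>N. \<forall>m\<ge>N. L2_set (\<lambda>x. norm (coord (X n) x - coord (X m) x)) F \<le> e"
        using L2_set_coord_le[OF \<open>finite F\<close>, of "X n - X _"] M[OF \<open>n \<ge> M\<close>]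
        by (metis (no_types, lifting) minus_ell2.rep_eq less_eq_real_def order_trans ext)
    qed
    then show ?thesis by blast
  qed
  obtain M0 where M0: "\<And>F. finite F \<Longrightarrow> L2_set (\<lambda>x. norm (coord (X M0) x - l x)) F \<le> 1"
    using close[of 1] by auto
  have "(\<lambda>x. (norm (l x))\<^sup>2) summable_on UNIV"
    using ell2_add(1)[of "coord (X M0)" "\<lambda>x. - (coord (X M0) x - l x)"] coord[of "X M0"]
      ell2I(1)[OF M0] by (simp add: norm_minus_commute)
  then have L: "coord (Abs_ell2 l) = l"
    by (simp add: Abs_ell2_inverse)
  have "X \<longlonglongrightarrow> Abs_ell2 l"
  proof (rule metric_LIMSEQ_I)
    fix e :: real assume "e > 0"
    then obtain M where M: "\<And>n F. n \<ge> M \<Longrightarrow> finite F \<Longrightarrow>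
        L2_set (\<lambda>x. norm (coord (X n) x - l x)) F \<le> e / 2"
      using close[of "e / 2"] by auto
    have "norm (X n - Abs_ell2 l) \<le> e / 2" if "n \<ge> M" for n
      by (rule norm_ell2_leI) (simp add: minus_ell2.rep_eq L M[OF that] del: le_divide_eq_numeral1)
    then show "\<exists>no. \<forall>n\<ge>no. dist (X n) (Abs_ell2 l) < e"
      using \<open>e > 0\<close> by (intro exI[of _ M]) (fastforce simp: dist_norm)
  qed
  then show "convergent X" by (auto simp: convergent_def)
qed

instantiation ell2 :: (type, complex_hilbert_space) complex_hilbert_space
begin

lift_definition scaleC_ell2 :: "complex \<Rightarrow> ('a, 'b) ell2 \<Rightarrow> ('a, 'b) ell2"
  is "\<lambda>a f x. a *\<^sub>C f x" by (rule ell2_scaleC)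

lift_definition cinner_ell2 :: "('a, 'b) ell2 \<Rightarrow> ('a, 'b) ell2 \<Rightarrow> complex"
  is "\<lambda>f g. \<Sum>\<^sub>\<infinity>x. cinner (f x) (g x)" .

instance
proof
  fix f g h :: "('a, 'b) ell2" and a b :: complex and r :: real
  show "a *\<^sub>C (f + g) = a *\<^sub>C f + a *\<^sub>C g" by transfer (simp add: scaleC_add_right)
  show "(a + b) *\<^sub>C f = a *\<^sub>C f + b *\<^sub>C f" by transfer (simp add: scaleC_add_left)
  show "a *\<^sub>C b *\<^sub>C f = (a * b) *\<^sub>C f" by transfer (simp add: scaleC_scaleC)
  show "r *\<^sub>R f = complex_of_real r *\<^sub>C f" by transfer (simp add: scaleR_scaleC)
  show "cinner f g = cnj (cinner g f)"
  proof transfer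
    fix f g :: "'a \<Rightarrow> 'b"
    have "cinner (f x) (g x) = cnj (cinner (g x) (f x))" for x by (rule cinner_commute)
    then show "(\<Sum>\<^sub>\<infinity>x. cinner (f x) (g x)) = cnj (\<Sum>\<^sub>\<infinity>x. cinner (g x) (f x))"
      by (metis (no_types, lifting) infsum_cnj infsum_cong)
  qed
  show "cinner (f + g) h = cinner f h + cinner g h"
    by transfer (simp add: cinner_add_left infsum_add summable_cinner)
  show "cinner (a *\<^sub>C f) g = a * cinner f g"
    by transfer (simp add: cinner_scaleC_left infsum_cmult_right')
  show "cinner f f = complex_of_real ((norm f)\<^sup>2)"
  proof transfer
    fix f :: "'a \<Rightarrow> 'b"
    assume "(\<lambda>x. (norm (f x))\<^sup>2) summable_on UNIV"
    then have "((\<lambda>x. complex_of_real ((norm (f x))\<^sup>2)) has_sum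
        complex_of_real (\<Sum>\<^sub>\<infinity>x. (norm (f x))\<^sup>2)) UNIV"
      by (intro has_sum_of_real has_sum_infsum)
    moreover have "(\<Sum>\<^sub>\<infinity>x. (norm (f x))\<^sup>2) \<ge> 0" by (intro infsum_nonneg) simp
    ultimately show "(\<Sum>\<^sub>\<infinity>x. cinner (f x) (f x))
        = complex_of_real ((sqrt (\<Sum>\<^sub>\<infinity>x. (norm (f x))\<^sup>2))\<^sup>2)"
      unfolding cinner_self_norm by (simp add: infsumI del: of_real_power)
  qed
qed

end

lemma norm_ell2_finite_support:
  fixes f :: "'g \<Rightarrow> 'o::complex_hilbert_space"
  assumes "finite F" "\<And>x. x \<notin> F \<Longrightarrow> f x = 0"
  shows "(\<lambda>x. (norm (f x))\<^sup>2) summable_on UNIV"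
  using has_sum_finite_neutralI[of F UNIV "\<lambda>x. (norm (f x))\<^sup>2", OF assms(1) _ _ refl] assms(2)
  by (auto simp: summable_on_def)

lift_definition chi :: "'g \<Rightarrow> ('g, complex) ell2" is "\<lambda>g x. if x = g then 1 else 0"
  by (rule norm_ell2_finite_support[of "{_}"]) auto

lift_definition tensor :: "('g, complex) ell2 \<Rightarrow> 'o \<Rightarrow> ('g, 'o::complex_hilbert_space) ell2"
    (infixr \<open>\<otimes>\<close> 70)
  is "\<lambda>f h x. f x *\<^sub>C h"
  using summable_on_cmult_left by (fastforce simp: norm_scaleC power_mult_distrib)

lemma cinner_tensor: "cinner (f \<otimes> h) (f' \<otimes> h') = cinner f f' * cinner h h'"
proof transfer
  fix f f' :: "'a \<Rightarrow> complex" and h h' :: 'b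
  have "cinner (f x *\<^sub>C h) (f' x *\<^sub>C h') = cinner (f x) (f' x) * cinner h h'" for x
    by (simp add: cinner_scaleC_left cinner_scaleC_right cinner_complex_def)
  then show "(\<Sum>\<^sub>\<infinity>x. cinner (f x *\<^sub>C h) (f' x *\<^sub>C h')) = (\<Sum>\<^sub>\<infinity>x. cinner (f x) (f' x)) * cinner h h'"
    by (simp add: infsum_cmult_left')
qed

lemma coord_sum: "coord (\<Sum>x\<in>F. f x) y = (\<Sum>x\<in>F. coord (f x) y)"
  by (induction F rule: infinite_finite_induct) (simp_all add: zero_ell2.rep_eq plus_ell2.rep_eq)

lemma coord_sum_chi:
  assumes "finite F"
  shows "coord (\<Sum>x\<in>F. chi x \<otimes> u x) y = (if y \<in> F then u y else 0)"
proof -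
  have "coord (chi x \<otimes> u x) y = (if x = y then u x else 0)" for x
    using scaleC_one scaleR_scaleC[of 0 "u x"] by (auto simp: tensor.rep_eq chi.rep_eq)
  then show ?thesis using assms by (simp add: coord_sum)
qed

lemma has_sum_chi_tensor: "((\<lambda>x. chi x \<otimes> coord f x) has_sum f) UNIV"
  unfolding has_sum_def
proof (rule tendstoI)
  fix e :: real assume "e > 0"
  have s: "(\<lambda>x. (norm (coord f x))\<^sup>2) summable_on UNIV" using coord[of f] by simp
  obtain F where F: "finite F"
    "\<And>F'. finite F' \<Longrightarrow> F \<subseteq> F' \<Longrightarrow>
      dist (\<Sum>x\<in>F'. (norm (coord f x))\<^sup>2) (\<Sum>\<^sub>\<infinity>x. (norm (coord f x))\<^sup>2) < (e/2)\<^sup>2"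
    using tendstoD[OF has_sum_infsum[OF s, unfolded has_sum_def], of "(e/2)\<^sup>2"] \<open>e > 0\<close>
    unfolding eventually_finite_subsets_at_top by auto
  have "norm ((\<Sum>x\<in>F'. chi x \<otimes> coord f x) - f) \<le> e/2" if F': "finite F'" "F \<subseteq> F'" for F'
  proof (rule norm_ell2_leI)
    fix E :: "'a set" assume "finite E"
    have "(\<Sum>x\<in>E. (norm (coord ((\<Sum>x\<in>F'. chi x \<otimes> coord f x) - f) x))\<^sup>2)
        = (\<Sum>x\<in>E - F'. (norm (coord f x))\<^sup>2)"
      using \<open>finite E\<close> F'(1)
      by (intro sum.mono_neutral_cong_right) (auto simp: minus_ell2.rep_eq coord_sum_chi)
    also have "\<dots> = (\<Sum>x\<in>F' \<union> E. (norm (coord f x))\<^sup>2) - (\<Sum>x\<in>F'. (norm (coord f x))\<^sup>2)"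
      using sum.subset_diff[of F' "F' \<union> E" "\<lambda>x. (norm (coord f x))\<^sup>2"] \<open>finite E\<close> F'(1)
      by (simp add: Un_Diff)
    also have "\<dots> \<le> (\<Sum>\<^sub>\<infinity>x. (norm (coord f x))\<^sup>2) - (\<Sum>x\<in>F'. (norm (coord f x))\<^sup>2)"
      using finite_sum_le_infsum[OF s, of "F' \<union> E"] \<open>finite E\<close> F'(1) by simp
    also have "\<dots> \<le> (e/2)\<^sup>2"
      using F(2)[OF F'] by (simp add: dist_real_def)
    finally show "L2_set (\<lambda>x. norm (coord ((\<Sum>x\<in>F'. chi x \<otimes> coord f x) - f) x)) E \<le> e/2"
      unfolding L2_set_def using \<open>e > 0\<close> by (intro real_le_lsqrt) auto
  qed
  then show "\<forall>\<^sub>F F in finite_subsets_at_top UNIV. dist (\<Sum>x\<in>F. chi x \<otimes> coord f x) f < e"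
    unfolding eventually_finite_subsets_at_top using F(1) \<open>e > 0\<close>
    by (intro exI[of _ F]) (fastforce simp: dist_norm)
qed

lemma tensor_total:
  "closure (span (range (\<lambda>(f, h). f \<otimes> h))) = (UNIV :: ('g, 'o::complex_hilbert_space) ell2 set)"
proof -
  have "f \<in> closure (span (range (\<lambda>(f, h). f \<otimes> h)))" for f :: "('g, 'o) ell2"
  proof (rule Lim_in_closed_set)
    show "((\<lambda>F. \<Sum>x\<in>F. chi x \<otimes> coord f x) \<longlongrightarrow> f) (finite_subsets_at_top UNIV)"
      using has_sum_chi_tensor[of f] by (simp add: has_sum_def)
    have "(\<Sum>x\<in>F. chi x \<otimes> coord f x) \<in> span (range (\<lambda>(f, h). f \<otimes> h))" for F
      by (intro span_sum span_base) auto
    then show "\<forall>\<^sub>F F in finite_subsets_at_top UNIV.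
        (\<Sum>x\<in>F. chi x \<otimes> coord f x) \<in> closure (span (range (\<lambda>(f, h). f \<otimes> h)))"
      using closure_subset by (intro always_eventually) blast
  qed auto
  then show ?thesis by blast
qed

section \<open>Bounded operators and von Neumann algebras\<close>

definition bounded_clinear ::
    "('a::complex_hilbert_space \<Rightarrow> 'b::complex_hilbert_space) \<Rightarrow> bool"
  where "bounded_clinear T \<longleftrightarrow> bounded_linear T \<and> (\<forall>c x. T (c *\<^sub>C x) = c *\<^sub>C T x)"

definition cadjoint ::
    "('a::complex_hilbert_space \<Rightarrow> 'b::complex_hilbert_space) \<Rightarrow> 'b \<Rightarrow> 'a"
  where "cadjoint T = (THE S. bounded_clinear S \<and> (\<forall>x y. cinner (T x) y = cinner x (S y)))"

definition unitary :: "('a::complex_hilbert_space \<Rightarrow> 'a) \<Rightarrow> bool"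
  where "unitary U \<longleftrightarrow> bounded_clinear U \<and> cadjoint U \<circ> U = id \<and> U \<circ> cadjoint U = id"

definition commutant :: "('a::complex_hilbert_space \<Rightarrow> 'a) set \<Rightarrow> ('a \<Rightarrow> 'a) set"
  where "commutant S = {T. bounded_clinear T \<and> (\<forall>R\<in>S. T \<circ> R = R \<circ> T)}"

text \<open>A von Neumann algebra is a self-adjoint set of bounded operators equal to its bicommutant.\<close>

definition von_neumann_algebra :: "('a::complex_hilbert_space \<Rightarrow> 'a) set \<Rightarrow> bool"
  where "von_neumann_algebra M \<longleftrightarrow>
    (\<forall>T\<in>M. bounded_clinear T \<and> cadjoint T \<in> M) \<and> commutant (commutant M) = M"

definition vN_generated :: "('a::complex_hilbert_space \<Rightarrow> 'a) set \<Rightarrow> ('a \<Rightarrow> 'a) set"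
  where "vN_generated S = \<Inter> {M. von_neumann_algebra M \<and> S \<subseteq> M}"

text \<open>For bounded \<open>S\<close> and \<open>T\<close>, \<open>S \<otimes>\<^sub>o\<^sub>p T\<close> is the unique bounded operator extending \<open>f \<otimes> h \<mapsto> S f \<otimes> T h\<close>.\<close>

definition op_tensor ::
    "(('g, complex) ell2 \<Rightarrow> ('g, complex) ell2) \<Rightarrow> ('o \<Rightarrow> 'o)
      \<Rightarrow> ('g, 'o::complex_hilbert_space) ell2 \<Rightarrow> ('g, 'o) ell2" (infixr \<open>\<otimes>\<^sub>o\<^sub>p\<close> 70)
  where "S \<otimes>\<^sub>o\<^sub>p T = (THE R. bounded_clinear R \<and> (\<forall>f h. R (f \<otimes> h) = S f \<otimes> T h))"

definition vN_tensor ::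
    "(('g, complex) ell2 \<Rightarrow> ('g, complex) ell2) set \<Rightarrow> ('o \<Rightarrow> 'o) set
      \<Rightarrow> (('g, 'o::complex_hilbert_space) ell2 \<Rightarrow> ('g, 'o) ell2) set"
    (infixr \<open>\<otimes>\<^sub>v\<^sub>N\<close> 70)
  where "M \<otimes>\<^sub>v\<^sub>N N = vN_generated {S \<otimes>\<^sub>o\<^sub>p T | S T. S \<in> M \<and> T \<in> N}"

section \<open>Group representations and Parseval frame generators\<close>

text \<open>
  The discrete group is the type \<open>'g::group_add\<close>, the library's class of not necessarily
  commutative groups.  It is written additively: \<open>g + h\<close> is the product, \<open>0\<close> the identity \<open>e\<close>
  and \<open>- g\<close> the inverse.
\<close>

definition unitary_rep :: "('g::group_add \<Rightarrow> 'h::complex_hilbert_space \<Rightarrow> 'h) \<Rightarrow> bool"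
  where "unitary_rep \<pi> \<longleftrightarrow> (\<forall>g. unitary (\<pi> g)) \<and> (\<forall>g h. \<pi> (g + h) = \<pi> g \<circ> \<pi> h)"

lemma ell2_translate:
  fixes f :: "'g::group_add \<Rightarrow> 'o::complex_hilbert_space"
  assumes "(\<lambda>x. (norm (f x))\<^sup>2) summable_on UNIV"
  shows "(\<lambda>x. (norm (f (x + g)))\<^sup>2) summable_on UNIV"
proof -
  have "bij (\<lambda>x. x + g)"
    by (rule bij_betw_byWitness[of _ "\<lambda>x. x - g"]) auto
  then show ?thesis
    using assms summable_on_reindex_bij_betw[of "\<lambda>x. x + g" UNIV UNIV "\<lambda>x. (norm (f x))\<^sup>2"] by simp
qed

lift_definition right_regular ::
    "'g::group_add \<Rightarrow> ('g, complex) ell2 \<Rightarrow> ('g, complex) ell2" is "\<lambda>g f x. f (x + g)"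
  by (rule ell2_translate)

lemma right_regular_chi: "right_regular g (chi h) = chi (h - g)"
  by transfer (auto simp: fun_eq_iff algebra_simps)

definition right_group_vN :: "(('g::group_add, complex) ell2 \<Rightarrow> ('g, complex) ell2) set" (\<open>\<R>\<close>)
  where "\<R> = vN_generated (range right_regular)"

text \<open>Convergence in the strong operator topology is expressed pointwise, by \<open>has_sum\<close> (the limit along
  the net of finite partial sums).\<close>

definition parseval_frame_generator ::
    "('g::group_add \<Rightarrow> 'h::complex_hilbert_space \<Rightarrow> 'h)
      \<Rightarrow> ('h \<Rightarrow> 'o::complex_hilbert_space) \<Rightarrow> bool"
  where "parseval_frame_generator \<pi> A \<longleftrightarrow> bounded_clinear A \<and>
    (\<forall>x. ((\<lambda>g. \<pi> g (cadjoint A (A (\<pi> (- g) x)))) has_sum x) UNIV)"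

definition L_op :: "'g \<Rightarrow> 'o \<Rightarrow> ('g, 'o::complex_hilbert_space) ell2"
  where "L_op g h = chi g \<otimes> h"

text \<open>For a Parseval frame generator the following sum converges for every \<open>x\<close>.\<close>

definition analysis_op ::
    "('g::group_add \<Rightarrow> 'h::complex_hilbert_space \<Rightarrow> 'h) \<Rightarrow> ('h \<Rightarrow> 'o)
      \<Rightarrow> 'h \<Rightarrow> ('g, 'o::complex_hilbert_space) ell2"
  where "analysis_op \<pi> A x = (\<Sum>\<^sub>\<infinity>g. L_op g (A (\<pi> (- g) x)))"

definition frame_projection ::
    "('g::group_add \<Rightarrow> 'h::complex_hilbert_space \<Rightarrow> 'h) \<Rightarrow> ('h \<Rightarrow> 'o)
      \<Rightarrow> ('g, 'o::complex_hilbert_space) ell2 \<Rightarrow> ('g, 'o) ell2"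
  where "frame_projection \<pi> A = analysis_op \<pi> A \<circ> cadjoint (analysis_op \<pi> A)"

end

theory Submission
  imports Defs
begin

text \<open>
  Let \<open>\<theta>\<close> be the analysis operator of \<open>A\<close>.  Its coordinates are \<open>A (\<pi> (- g) x)\<close>, so it is an isometry that
  intertwines \<open>\<pi>\<close> with the left translations \<open>\<lambda>\<^sub>g \<otimes> I\<close>, and \<open>A\<close> is recovered as the coordinate at the
  identity.  Consequently, if \<open>X\<close> commutes with left translations and \<open>B x\<close> is the coordinate at the
  identity of \<open>X (\<theta> x)\<close>, then the analysis operator of \<open>B\<close> is \<open>X \<circ> \<theta>\<close> (\<open>analysis_op_eq_compose\<close>) and its frame
  projection is \<open>X \<circ> P \<circ> X\<^sup>*\<close>.  This gives all the formulas for frame projections.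

  To apply it, the von Neumann algebras are identified with commutants: \<open>\<R>\<close> is the commutant of the left
  translations on scalar-valued families, and its tensor product with all bounded operators is the commutant
  of the left translations on vector-valued families.  Both follow from \<open>translation_commutation\<close>: an
  operator \<open>X\<close> that commutes with left translations commutes with every operator \<open>Y\<close> that commutes with right
  translations and with all \<open>I \<otimes> T\<close>.  The proof compares matrix entries; the two products \<open>X \<circ> Y\<close> and
  \<open>Y \<circ> X\<close> are given by the same series after a change of summation variable.

  For the first equivalence, equal frame projections give the unitary \<open>U = \<theta>\<^sub>A\<^sup>* \<theta>\<^sub>B\<close> in the commutant of the
  representation, and such a \<open>U\<close> gives \<open>W = \<theta> U \<theta>\<^sup>* + (I - P)\<close>.

  For unitaries in the bicommutant of the representation, let \<open>V\<close> be the transpose of \<open>W\<close>, obtained from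
  the adjoint by the conjugation \<open>f \<mapsto> (x \<mapsto> cnj (f (- x)))\<close>.  It commutes with right translations and has the
  same row as \<open>W\<close> at the identity, so \<open>V \<otimes> I\<close> may replace \<open>W \<otimes> I\<close> in the formula for \<open>B\<close>, and it commutes with
  the frame projection.  The task is to match \<open>U\<close> and \<open>V\<close> with \<open>\<theta> U = (V \<otimes> I) \<theta>\<close>.  Given \<open>V\<close>, the compression
  \<open>U = \<theta>\<^sup>* (V \<otimes> I) \<theta>\<close> is the required unitary.  Given \<open>U\<close>, the right translates of the scalar coefficients of
  \<open>\<theta> x\<close> and of \<open>\<theta> (U x)\<close> have the same Gram matrix, because its entries come from operators in the commutant
  of the representation; \<open>gram_unitary_exists\<close> then provides a unitary \<open>V\<close> that maps the former to the
  latter and commutes with right translations.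
\<close>

section \<open>Hilbert space preliminaries\<close>

lemma cinner_zero_left [simp]: "cinner 0 (y::'a::complex_hilbert_space) = 0"
  using cinner_add_left[of 0 0 y] by simp

lemma cinner_zero_right [simp]: "cinner (y::'a::complex_hilbert_space) 0 = 0"
  using cinner_add_right[of y 0 0] by simp

lemma cinner_minus_left: "cinner (- x) (y::'a::complex_hilbert_space) = - cinner x y"
  using cinner_add_left[of x "- x" y] by (simp add: add_eq_0_iff)

lemma cinner_minus_right: "cinner (y::'a::complex_hilbert_space) (- x) = - cinner y x"
  using cinner_add_right[of y x "- x"] by (simp add: add_eq_0_iff)

lemma cinner_diff_left: "cinner (x - y) (z::'a::complex_hilbert_space) = cinner x z - cinner y z"
  using cinner_add_left[of x "- y" z] by (simp add: cinner_minus_left)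

lemma cinner_diff_right: "cinner (z::'a::complex_hilbert_space) (x - y) = cinner z x - cinner z y"
  using cinner_add_right[of z x "- y"] by (simp add: cinner_minus_right)

lemma cinner_scaleR_left: "cinner (r *\<^sub>R x) (y::'a::complex_hilbert_space) = r * cinner x y"
  by (simp add: scaleR_scaleC cinner_scaleC_left)

lemma cinner_scaleR_right: "cinner (y::'a::complex_hilbert_space) (r *\<^sub>R x) = r * cinner y x"
  by (simp add: scaleR_scaleC cinner_scaleC_right)

lemma cinner_eq_zero_iff [simp]: "cinner x x = 0 \<longleftrightarrow> (x::'a::complex_hilbert_space) = 0"
  by (simp add: cinner_self_norm)

lemma cinner_extI:
  fixes x y :: "'a::complex_hilbert_space"
  assumes "\<And>z. cinner x z = cinner y z"
  shows "x = y"
  using assms[of "x - y"] cinner_eq_zero_iff[of "x - y"] by (simp add: cinner_diff_left)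

lemma cinner_extI_right:
  fixes x y :: "'a::complex_hilbert_space"
  assumes "\<And>z. cinner z x = cinner z y"
  shows "x = y"
  by (rule cinner_extI) (metis assms cinner_commute)

lemma norm_sq_add:
  fixes x y :: "'a::complex_hilbert_space"
  shows "(norm (x + y))\<^sup>2 = (norm x)\<^sup>2 + (norm y)\<^sup>2 + 2 * Re (cinner x y)"
proof -
  have "cinner (x + y) (x + y) = cinner x x + cinner y y + (cinner x y + cnj (cinner x y))"
    by (simp add: cinner_add_left cinner_add_right cinner_commute[symmetric])
  then have "Re (cinner (x + y) (x + y)) = Re (cinner x x) + Re (cinner y y) + 2 * Re (cinner x y)"
    by simp
  then show ?thesis
    unfolding cinner_self_norm Re_complex_of_real .
qed

lemma norm_sq_diff:
  fixes x y :: "'a::complex_hilbert_space"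
  shows "(norm (x - y))\<^sup>2 = (norm x)\<^sup>2 + (norm y)\<^sup>2 - 2 * Re (cinner x y)"
  using norm_sq_add[of x "- y"] by (simp add: cinner_minus_right)

lemma scaleC_zero [simp]:
  "0 *\<^sub>C (x::'a::complex_hilbert_space) = 0" "c *\<^sub>C (0::'a) = 0"
  using scaleC_add_left[of 0 0 x] scaleC_add_right[of c "0::'a" 0] by simp_all

lemma bounded_linear_cinner_left: "bounded_linear (\<lambda>x. cinner x (y::'a::complex_hilbert_space))"
  by (rule bounded_linear_intro[of _ "norm y"])
    (simp_all add: cinner_add_left cinner_scaleR_left cinner_Cauchy_Schwarz scaleR_conv_of_real)

lemma bounded_linear_cinner_right: "bounded_linear (\<lambda>x. cinner (y::'a::complex_hilbert_space) x)"
  by (rule bounded_linear_intro[of _ "norm y"])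
    (use cinner_Cauchy_Schwarz[of y] in \<open>simp_all add: cinner_add_right cinner_scaleR_right
      scaleR_conv_of_real mult.commute\<close>)

lemmas tendsto_cinner_left = bounded_linear.tendsto[OF bounded_linear_cinner_left]

lemma bounded_linear_scaleC: "bounded_linear (\<lambda>x::'a::complex_hilbert_space. c *\<^sub>C x)"
  by (rule bounded_linear_intro[of _ "cmod c"])
    (simp_all add: scaleC_add_right scaleR_scaleC scaleC_scaleC norm_scaleC mult.commute)

subsection \<open>Bounded complex-linear maps\<close>

lemma bounded_clinearI:
  assumes "\<And>x y. T (x + y) = T x + T y" "\<And>c x. T (c *\<^sub>C x) = c *\<^sub>C T x"
    and "\<And>x. norm (T x) \<le> K * norm x"
  shows "bounded_clinear T"
  unfolding bounded_clinear_def
  by (auto simp: assms(1,2) scaleR_scaleC mult.commute intro!: bounded_linear_intro[of _ K] assms(3))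

lemma bounded_clinear_bounded_linear: "bounded_clinear T \<Longrightarrow> bounded_linear T"
  by (simp add: bounded_clinear_def)

lemma bounded_clinear_add: "bounded_clinear T \<Longrightarrow> T (x + y) = T x + T y"
  by (simp add: bounded_clinear_def linear_simps)

lemma bounded_clinear_diff: "bounded_clinear T \<Longrightarrow> T (x - y) = T x - T y"
  by (simp add: bounded_clinear_def linear_simps)

lemma bounded_clinear_zero: "bounded_clinear T \<Longrightarrow> T 0 = 0"
  by (simp add: bounded_clinear_def linear_simps)

lemma bounded_clinear_scaleC: "bounded_clinear T \<Longrightarrow> T (c *\<^sub>C x) = c *\<^sub>C T x"
  by (simp add: bounded_clinear_def)

lemmas bounded_clinear_simps = bounded_clinear_add bounded_clinear_diff bounded_clinear_zero
  bounded_clinear_scaleC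

lemma bounded_clinear_bound:
  assumes "bounded_clinear T"
  obtains K where "K \<ge> 0" "\<And>x. norm (T x) \<le> K * norm x"
  using bounded_linear.nonneg_bounded[OF bounded_clinear_bounded_linear[OF assms]]
  by (metis mult.commute)

lemma bounded_clinear_compose:
  "bounded_clinear S \<Longrightarrow> bounded_clinear T \<Longrightarrow> bounded_clinear (S \<circ> T)"
  unfolding bounded_clinear_def o_def by (auto intro: bounded_linear_compose)

lemma bounded_clinear_id: "bounded_clinear id"
  by (rule bounded_clinearI[of _ 1]) auto

lemma scaleC_minus_right: "c *\<^sub>C (- x) = - (c *\<^sub>C (x::'a::complex_hilbert_space))"
  using scaleC_add_right[of c x "- x"] by (simp add: add_eq_0_iff)

lemma scaleC_diff_right: "c *\<^sub>C (x - y) = c *\<^sub>C x - c *\<^sub>C (y::'a::complex_hilbert_space)"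
  using scaleC_add_right[of c x "- y"] by (simp add: scaleC_minus_right)

lemma bounded_clinear_plus:
  "bounded_clinear S \<Longrightarrow> bounded_clinear T \<Longrightarrow> bounded_clinear (\<lambda>x. S x + T x)"
  unfolding bounded_clinear_def by (simp add: bounded_linear_add scaleC_add_right)

lemma bounded_clinear_minus:
  "bounded_clinear S \<Longrightarrow> bounded_clinear T \<Longrightarrow> bounded_clinear (\<lambda>x. S x - T x)"
  unfolding bounded_clinear_def by (simp add: bounded_linear_sub scaleC_diff_right)

lemma bounded_clinear_cinner_left: "bounded_clinear (\<lambda>x. cinner x (y::'a::complex_hilbert_space))"
  by (simp add: bounded_clinear_def bounded_linear_cinner_left cinner_scaleC_left scaleC_complex_def)

subsection \<open>Orthogonal projection and adjoints\<close>

text \<open>The projection theorem.  A minimizing sequence for the distance from \<open>x\<close> to \<open>K\<close> is Cauchy by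
  the parallelogram law, and the minimizing property of its limit forces orthogonality.\<close>

lemma closest_point_orthogonal:
  fixes x :: "'a::complex_hilbert_space"
  assumes sub: "subspace K" and scale: "\<And>c k. k \<in> K \<Longrightarrow> c *\<^sub>C k \<in> K" and "closed K"
  obtains p where "p \<in> K" "\<And>k. k \<in> K \<Longrightarrow> cinner (x - p) k = 0"
proof -
  define d where "d = (INF k\<in>K. (norm (x - k))\<^sup>2)"
  have "K \<noteq> {}" using subspace_0[OF sub] by blast
  have bdd: "bdd_below ((\<lambda>k. (norm (x - k))\<^sup>2) ` K)" by (rule bdd_belowI2[of _ 0]) simp
  have d_le: "d \<le> (norm (x - k))\<^sup>2" if "k \<in> K" for k
    unfolding d_def by (rule cINF_lower[OF bdd that])
  have "\<exists>k\<in>K. (norm (x - k))\<^sup>2 < d + 1 / real (Suc n)" for n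
    using cINF_less_iff[OF \<open>K \<noteq> {}\<close> bdd, of "d + 1 / real (Suc n)"] by (simp add: d_def)
  then obtain k where k: "\<And>n. k n \<in> K" "\<And>n. (norm (x - k n))\<^sup>2 < d + 1 / real (Suc n)" by metis
  have k_dist: "(norm (k m - k n))\<^sup>2 \<le> 2 / real (Suc m) + 2 / real (Suc n)" for m n
  proof -
    have mid: "(1/2) *\<^sub>R (k m + k n) \<in> K"
      using sub k(1) by (intro subspace_scale subspace_add)
    have "(x - k m) + (x - k n) = 2 *\<^sub>R (x - (1/2) *\<^sub>R (k m + k n))"
      by (simp add: algebra_simps scaleR_2)
    then have "4 * d \<le> (norm ((x - k m) + (x - k n)))\<^sup>2"
      using d_le[OF mid] by (simp add: power_mult_distrib)
    moreover have "(norm (k m - k n))\<^sup>2 = (norm ((x - k n) - (x - k m)))\<^sup>2" by simp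
    ultimately show ?thesis
      using norm_sq_add[of "x - k m" "x - k n"] norm_sq_diff[of "x - k n" "x - k m"]
        k(2)[of m] k(2)[of n] cinner_commute[of "x - k n" "x - k m"]
      by simp
  qed
  have "Cauchy k"
  proof (rule CauchyI)
    fix e :: real assume "e > 0"
    then obtain M where M: "inverse (real (Suc M)) < e\<^sup>2 / 4"
      using reals_Archimedean[of "e\<^sup>2 / 4"] by auto
    have "norm (k m - k n) < e" if "m \<ge> M" "n \<ge> M" for m n
    proof -
      have "1 / real (Suc m) \<le> 1 / real (Suc M)" "1 / real (Suc n) \<le> 1 / real (Suc M)"
        using that by (simp_all add: frac_le)
      then have "(norm (k m - k n))\<^sup>2 < e\<^sup>2"
        using k_dist[of m n] M by (simp add: inverse_eq_divide)
      then show ?thesis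
        using \<open>e > 0\<close> by (simp add: power2_less_imp_less)
    qed
    then show "\<exists>M. \<forall>m\<ge>M. \<forall>n\<ge>M. norm (k m - k n) < e" by blast
  qed
  then obtain p where p: "k \<longlonglongrightarrow> p" using Cauchy_convergent convergent_def by blast
  then have "p \<in> K" using closed_sequentially[OF \<open>closed K\<close>, of k p] k(1) by blast
  have "(\<lambda>n. d + inverse (real (Suc n))) \<longlonglongrightarrow> d + 0"
    by (intro tendsto_add tendsto_const LIMSEQ_inverse_real_of_nat)
  then have "(norm (x - p))\<^sup>2 \<le> d"
    using k(2) by (intro LIMSEQ_le[of "\<lambda>n. (norm (x - k n))\<^sup>2" _ "\<lambda>n. d + inverse (real (Suc n))"])
      (auto intro!: tendsto_intros p exI[of _ 0] simp: inverse_eq_divide less_imp_le)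
  then have p_min: "(norm (x - p))\<^sup>2 \<le> (norm (x - p - v))\<^sup>2" if "v \<in> K" for v
    using order_trans[OF _ d_le[OF subspace_add[OF sub \<open>p \<in> K\<close> that]]] by (simp only: diff_diff_eq)
  \<comment> \<open>The step \<open>t *\<^sub>R v\<close> that would decrease the distance most contradicts minimality.\<close>
  have Re0: "Re (cinner (x - p) v) \<le> 0" if v: "v \<in> K" for v
  proof (rule ccontr)
    define b where "b = Re (cinner (x - p) v)"
    assume "\<not> ?thesis"
    then have "b > 0" by (simp add: b_def)
    then have "v \<noteq> 0" by (auto simp: b_def)
    define t where "t = b / (norm v)\<^sup>2"
    have "t > 0" using \<open>b > 0\<close> \<open>v \<noteq> 0\<close> by (simp add: t_def)
    have "2 * t * b \<le> t\<^sup>2 * (norm v)\<^sup>2"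
      using p_min[OF subspace_scale[OF sub v, of t]] norm_sq_diff[of "x - p" "t *\<^sub>R v"]
      by (simp add: cinner_scaleR_right b_def power_mult_distrib)
    also have "t\<^sup>2 * (norm v)\<^sup>2 = t * b"
      using \<open>v \<noteq> 0\<close> by (simp add: t_def power2_eq_square)
    finally show False using \<open>t > 0\<close> \<open>b > 0\<close> by simp
  qed
  have "cinner (x - p) v = 0" if v: "v \<in> K" for v
  proof (rule complex_eqI)
    show "Re (cinner (x - p) v) = Re 0"
      using Re0[OF v] Re0[OF scale[OF v, of "-1"]] by (simp add: cinner_scaleC_right)
    show "Im (cinner (x - p) v) = Im 0"
      using Re0[OF scale[OF v, of "\<i>"]] Re0[OF scale[OF v, of "- \<i>"]]
      by (simp add: cinner_scaleC_right)
  qed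
  then show ?thesis using that \<open>p \<in> K\<close> by blast
qed

lemma riesz_representation:
  fixes \<phi> :: "'a::complex_hilbert_space \<Rightarrow> complex"
  assumes "bounded_clinear \<phi>"
  obtains y where "\<And>x. \<phi> x = cinner x y"
proof (cases "\<forall>x. \<phi> x = 0")
  case True
  then show ?thesis using that[of 0] by simp
next
  case False
  then obtain x0 where "\<phi> x0 \<noteq> 0" by blast
  note lin = bounded_clinear_simps[OF assms] scaleC_complex_def
  have "subspace {x. \<phi> x = 0}" 
    by (auto simp: subspace_def lin scaleR_scaleC)
  moreover have "closed {x. \<phi> x = 0}"
    using assms bounded_clinear_bounded_linear
    by (intro closed_Collect_eq) (auto intro!: linear_continuous_on)
  ultimately obtain p where p: "\<phi> p = 0" "\<And>k. \<phi> k = 0 \<Longrightarrow> cinner (x0 - p) k = 0"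
    using closest_point_orthogonal[of "{x. \<phi> x = 0}" x0] by (auto simp: lin)
  \<comment> \<open>\<open>z\<close> spans the orthogonal complement of the kernel of \<open>\<phi>\<close>.\<close>
  define z where "z = x0 - p"
  have "\<phi> z \<noteq> 0" using \<open>\<phi> x0 \<noteq> 0\<close> p(1) by (simp add: z_def lin)
  then have "cinner z z \<noteq> 0" by (auto simp: lin)
  have "\<phi> x = cinner x (cnj (\<phi> z / cinner z z) *\<^sub>C z)" for x
  proof -
    have "cinner z (x - (\<phi> x / \<phi> z) *\<^sub>C z) = 0"
      using \<open>\<phi> z \<noteq> 0\<close> unfolding z_def by (intro p(2)) (simp add: z_def[symmetric] lin)
    then have "cinner (x - (\<phi> x / \<phi> z) *\<^sub>C z) z = 0"
      using cinner_commute by (metis complex_cnj_zero)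
    then have "cinner x z = \<phi> x / \<phi> z * cinner z z"
      by (simp add: cinner_diff_left cinner_scaleC_left)
    then show ?thesis
      using \<open>\<phi> z \<noteq> 0\<close> \<open>cinner z z \<noteq> 0\<close> by (simp add: cinner_scaleC_right)
  qed
  then show ?thesis by (rule that)
qed

lemma cadjoint_eqI:
  assumes "bounded_clinear S" "\<And>x y. cinner (T x) y = cinner x (S y)"
  shows "cadjoint T = S"
  unfolding cadjoint_def
proof (rule the_equality)
  fix R assume R: "bounded_clinear R \<and> (\<forall>x y. cinner (T x) y = cinner x (R y))"
  show "R = S"
  proof
    fix y show "R y = S y"
      by (rule cinner_extI_right) (use R assms(2) in simp)
  qed
qed (use assms in blast)

lemma cadjoint_exists:
  assumes "bounded_clinear T"
  shows "\<exists>S. bounded_clinear S \<and> (\<forall>x y. cinner (T x) y = cinner x (S y))"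
proof -
  have "\<exists>z. \<forall>x. cinner (T x) y = cinner x z" for y
    using bounded_clinear_compose[OF bounded_clinear_cinner_left[of y] assms]
    by (rule riesz_representation) (auto simp: o_def)
  then obtain S where S: "\<And>x y. cinner (T x) y = cinner x (S y)" by metis
  obtain K where K: "K \<ge> 0" "\<And>x. norm (T x) \<le> K * norm x"
    using bounded_clinear_bound[OF assms] by blast
  have "bounded_clinear S"
  proof (rule bounded_clinearI[of _ K])
    fix x y c
    show "S (x + y) = S x + S y"
      by (rule cinner_extI_right) (simp add: S[symmetric] cinner_add_right)
    show "S (c *\<^sub>C x) = c *\<^sub>C S x"
      by (rule cinner_extI_right) (simp add: S[symmetric] cinner_scaleC_right)
    show "norm (S x) \<le> K * norm x"
    proof (cases "S x = 0")
      case False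
      have "complex_of_real ((norm (S x))\<^sup>2) = cinner (T (S x)) x"
        by (simp only: S cinner_self_norm)
      then have "(norm (S x))\<^sup>2 = cmod (cinner (T (S x)) x)"
        by (metis abs_of_nonneg norm_of_real zero_le_power2)
      also have "\<dots> \<le> norm (T (S x)) * norm x" by (rule cinner_Cauchy_Schwarz)
      also have "\<dots> \<le> (K * norm (S x)) * norm x" by (intro mult_right_mono K) simp
      finally show ?thesis using False by (simp add: power2_eq_square mult_ac)
    qed (use K in simp)
  qed
  then show ?thesis using S by blast
qed

lemma
  assumes "bounded_clinear T"
  shows bounded_clinear_cadjoint: "bounded_clinear (cadjoint T)"
    and cadjoint_right: "cinner (T x) y = cinner x (cadjoint T y)"
  using cadjoint_exists[OF assms] cadjoint_eqI by blast+

lemma cadjoint_left: "bounded_clinear T \<Longrightarrow> cinner (cadjoint T x) y = cinner x (T y)"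
  by (metis cadjoint_right cinner_commute)

lemma cadjoint_cadjoint: "bounded_clinear T \<Longrightarrow> cadjoint (cadjoint T) = T"
  by (rule cadjoint_eqI) (simp_all add: cadjoint_left)

lemma cadjoint_compose:
  assumes "bounded_clinear S" "bounded_clinear T"
  shows "cadjoint (S \<circ> T) = cadjoint T \<circ> cadjoint S"
  by (rule cadjoint_eqI)
    (simp_all add: assms bounded_clinear_compose bounded_clinear_cadjoint cadjoint_right)

lemma unitaryI:
  assumes "bounded_clinear S" "bounded_clinear T" "\<And>x y. cinner (S x) y = cinner x (T y)"
    and "\<And>x. S (T x) = x" "\<And>x. T (S x) = x"
  shows "unitary S" "cadjoint S = T"
  using cadjoint_eqI[OF assms(2,3)] assms by (auto simp: unitary_def)

lemma isometry_cinner: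
  fixes T :: "'a::complex_hilbert_space \<Rightarrow> 'b::complex_hilbert_space"
  assumes T: "bounded_clinear T" and iso: "\<And>x. norm (T x) = norm x"
  shows "cinner (T x) (T y) = cinner x y"
proof -
  have Re: "Re (cinner (T x) (T y)) = Re (cinner x y)" for x y
    using norm_sq_add[of "T x" "T y"] norm_sq_add[of x y] iso[of "x + y"]
    by (simp add: bounded_clinear_add[OF T] iso)
  have "Re (cinner (T x) (T (\<i> *\<^sub>C y))) = Re (cinner x (\<i> *\<^sub>C y))" by (rule Re)
  then have "Im (cinner (T x) (T y)) = Im (cinner x y)"
    by (simp add: bounded_clinear_scaleC[OF T] cinner_scaleC_right)
  with Re show ?thesis by (simp add: complex_eq_iff)
qed

lemma unitary_surj_isometryI:
  assumes S: "bounded_clinear S" and iso: "\<And>x y. cinner (S x) (S y) = cinner x y" and "surj S"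
  shows "unitary S"
proof -
  have "cadjoint S (S x) = x" for x
    by (rule cinner_extI) (simp add: cadjoint_left S iso)
  moreover from this have "S (cadjoint S y) = y" for y
    using \<open>surj S\<close> by (metis surjD)
  ultimately show ?thesis using S by (auto simp: unitary_def)
qed

lemma
  assumes "unitary U"
  shows unitary_bounded_clinear: "bounded_clinear U"
    and unitary_cadjoint_cancel: "cadjoint U (U x) = x" "U (cadjoint U x) = x"
  using assms by (auto simp: unitary_def fun_eq_iff)

lemma unitary_cinner: "unitary U \<Longrightarrow> cinner (U x) (U y) = cinner x y"
  by (simp add: cadjoint_right unitary_bounded_clinear unitary_cadjoint_cancel)

section \<open>Operators on vector-valued square-summable families\<close>

lemma ell2_eqI: "(\<And>x. coord f x = coord g x) \<Longrightarrow> f = g"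
  by (metis coord_inject ext)

lemma bounded_clinear_coord: "bounded_clinear (\<lambda>f. coord f x)"
  by (rule bounded_clinearI[of _ 1]) (simp_all add: plus_ell2.rep_eq scaleC_ell2.rep_eq norm_coord_le)

lemma coord_chi_tensor: "coord (chi x \<otimes> h) y = (if y = x then h else 0)"
  by (simp add: tensor.rep_eq chi.rep_eq scaleC_one)

lemma cinner_chi_tensor: "cinner f (chi x \<otimes> h) = cinner (coord f x) h"
proof -
  have "cinner f (chi x \<otimes> h) = (\<Sum>\<^sub>\<infinity>y. cinner (coord f y) (coord (chi x \<otimes> h) y))"
    by (simp add: cinner_ell2.rep_eq)
  also have "\<dots> = (\<Sum>\<^sub>\<infinity>y\<in>{x}. cinner (coord f y) h)"
    by (rule infsum_cong_neutral) (auto simp: coord_chi_tensor)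
  also have "\<dots> = cinner (coord f x) h" by simp
  finally show ?thesis .
qed

lemma norm_tensor: "norm (f \<otimes> h) = norm f * norm h"
proof -
  have "complex_of_real ((norm (f \<otimes> h))\<^sup>2) = complex_of_real ((norm f * norm h)\<^sup>2)"
    unfolding cinner_self_norm[symmetric] cinner_tensor
    by (simp add: cinner_self_norm power_mult_distrib)
  then show ?thesis unfolding of_real_eq_iff by (simp add: power2_eq_iff_nonneg)
qed

lemma bounded_clinear_tensor_left:
  fixes h :: "'o::complex_hilbert_space"
  shows "bounded_clinear (\<lambda>f::('g, complex) ell2. f \<otimes> h)"
proof (rule bounded_clinearI[of _ "norm h"])
  show "(f + g) \<otimes> h = f \<otimes> h + g \<otimes> h" for f g :: "('g, complex) ell2"
    by transfer (simp add: scaleC_add_left)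
  show "(c *\<^sub>C f) \<otimes> h = c *\<^sub>C (f \<otimes> h)" for c and f :: "('g, complex) ell2"
    by transfer (simp add: scaleC_scaleC scaleC_complex_def)
qed (simp add: norm_tensor mult.commute)

lemma bounded_clinear_tensor_right:
  fixes f :: "('g, complex) ell2"
  shows "bounded_clinear (\<lambda>h::'o::complex_hilbert_space. f \<otimes> h)"
proof (rule bounded_clinearI[of _ "norm f"])
  show "f \<otimes> (h + k) = f \<otimes> h + f \<otimes> k" for h k :: 'o
    by transfer (simp add: scaleC_add_right)
  show "f \<otimes> (c *\<^sub>C h) = c *\<^sub>C (f \<otimes> h)" for c and h :: 'o
    by transfer (simp add: scaleC_scaleC mult.commute)
qed (simp add: norm_tensor)

lemma tensor_complex: "f \<otimes> (c::complex) = c *\<^sub>C f"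
  by transfer (simp add: scaleC_complex_def mult.commute)

lemma ell2_operator_eqI:
  assumes "bounded_clinear S" "bounded_clinear T"
    and "\<And>x h. S (chi x \<otimes> h) = T (chi x \<otimes> h)"
  shows "S = T"
proof
  fix f
  have "((\<lambda>x. S (chi x \<otimes> coord f x)) has_sum S f) UNIV"
    by (rule has_sum_bounded_linear[OF bounded_clinear_bounded_linear has_sum_chi_tensor])
      (rule assms)
  moreover have "((\<lambda>x. T (chi x \<otimes> coord f x)) has_sum T f) UNIV"
    by (rule has_sum_bounded_linear[OF bounded_clinear_bounded_linear has_sum_chi_tensor])
      (rule assms)
  ultimately show "S f = T f" by (simp add: assms(3) has_sum_unique)
qed

subsection \<open>Translations\<close>

text \<open>The left and right translations of vector-valued families; in tensor notation,
  \<open>\<lambda>\<^sub>g \<otimes> I\<close> and \<open>\<rho>\<^sub>g \<otimes> I\<close>.\<close>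

lift_definition ltrans ::
    "'g::group_add \<Rightarrow> ('g, 'o::complex_hilbert_space) ell2 \<Rightarrow> ('g, 'o) ell2"
  is "\<lambda>g f x. f (- g + x)"
proof -
  fix g :: 'g and f :: "'g \<Rightarrow> 'o"
  assume "(\<lambda>x. (norm (f x))\<^sup>2) summable_on UNIV"
  moreover have "bij (\<lambda>x. - g + x)"
    by (rule bij_betw_byWitness[of _ "\<lambda>x. g + x"]) (auto simp: add.assoc[symmetric])
  ultimately show "(\<lambda>x. (norm (f (- g + x)))\<^sup>2) summable_on UNIV"
    using summable_on_reindex_bij_betw[of "\<lambda>x. - g + x" UNIV UNIV "\<lambda>x. (norm (f x))\<^sup>2"] by simp
qed

lift_definition rtrans ::
    "'g::group_add \<Rightarrow> ('g, 'o::complex_hilbert_space) ell2 \<Rightarrow> ('g, 'o) ell2"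
  is "\<lambda>g f x. f (x + g)"
  by (rule ell2_translate)

lemma right_regular_eq_rtrans: "right_regular = rtrans"
  by (intro ext ell2_eqI) (simp add: right_regular.rep_eq rtrans.rep_eq)

lemma infsum_left_translate: "(\<Sum>\<^sub>\<infinity>x. \<phi> (g + x)) = (\<Sum>\<^sub>\<infinity>x. \<phi> (x::'g::group_add))"
proof (rule infsum_reindex_bij_betw)
  show "bij (\<lambda>x. g + x)"
    by (rule bij_betw_byWitness[of _ "\<lambda>x. - g + x"]) (auto simp: add.assoc[symmetric])
qed

lemma infsum_right_translate: "(\<Sum>\<^sub>\<infinity>x. \<phi> (x + g)) = (\<Sum>\<^sub>\<infinity>x. \<phi> (x::'g::group_add))"
proof (rule infsum_reindex_bij_betw)
  show "bij (\<lambda>x. x + g)"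
    by (rule bij_betw_byWitness[of _ "\<lambda>x. x - g"]) auto
qed

lemma norm_ltrans: "norm (ltrans g f) = norm f"
  using infsum_left_translate[of "\<lambda>x. (norm (coord f x))\<^sup>2" "- g"]
  by (simp add: norm_ell2.rep_eq ltrans.rep_eq)

lemma norm_rtrans: "norm (rtrans g f) = norm f"
  using infsum_right_translate[of "\<lambda>x. (norm (coord f x))\<^sup>2" g]
  by (simp add: norm_ell2.rep_eq rtrans.rep_eq)

lemma bounded_clinear_ltrans: "bounded_clinear (ltrans g)"
  by (rule bounded_clinearI[of _ 1])
    (auto intro!: ell2_eqI simp: plus_ell2.rep_eq ltrans.rep_eq scaleC_ell2.rep_eq norm_ltrans)

lemma bounded_clinear_rtrans: "bounded_clinear (rtrans g)"
  by (rule bounded_clinearI[of _ 1])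
    (auto intro!: ell2_eqI simp: plus_ell2.rep_eq rtrans.rep_eq scaleC_ell2.rep_eq norm_rtrans)

lemma cinner_ltrans: "cinner (ltrans g f) f' = cinner f (ltrans (- g) f')"
  using infsum_left_translate[of "\<lambda>x. cinner (coord f x) (coord f' (g + x))" "- g"]
  by (simp add: cinner_ell2.rep_eq ltrans.rep_eq add.assoc[symmetric])

lemma cinner_rtrans: "cinner (rtrans g f) f' = cinner f (rtrans (- g) f')"
  using infsum_right_translate[of "\<lambda>x. cinner (coord f x) (coord f' (x - g))" g]
  by (simp add: cinner_ell2.rep_eq rtrans.rep_eq)

lemma cadjoint_ltrans: "cadjoint (ltrans g) = ltrans (- g)"
  by (rule cadjoint_eqI[OF bounded_clinear_ltrans cinner_ltrans])

lemma cadjoint_rtrans: "cadjoint (rtrans g) = rtrans (- g)"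
  by (rule cadjoint_eqI[OF bounded_clinear_rtrans cinner_rtrans])

lemma ltrans_chi_tensor: "ltrans g (chi x \<otimes> h) = chi (g + x) \<otimes> h"
proof (rule ell2_eqI)
  fix y
  have "- g + y = x \<longleftrightarrow> y = g + x"
    by (metis add_minus_cancel minus_add_cancel)
  then show "coord (ltrans g (chi x \<otimes> h)) y = coord (chi (g + x) \<otimes> h) y"
    by (simp add: ltrans.rep_eq coord_chi_tensor)
qed

lemma rtrans_chi_tensor: "rtrans g (chi x \<otimes> h) = chi (x - g) \<otimes> h"
proof (rule ell2_eqI)
  fix y
  have "y + g = x \<longleftrightarrow> y = x - g" by (auto simp: algebra_simps)
  then show "coord (rtrans g (chi x \<otimes> h)) y = coord (chi (x - g) \<otimes> h) y"
    by (simp add: rtrans.rep_eq coord_chi_tensor)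
qed

lemma rtrans_tensor: "rtrans g (f \<otimes> h) = rtrans g f \<otimes> h"
  by transfer simp

lemma ltrans_tensor: "ltrans g (f \<otimes> h) = ltrans g f \<otimes> h"
  by transfer simp

lemma ltrans_rtrans: "ltrans g (rtrans h f) = rtrans h (ltrans g f)"
  by transfer (simp add: add.assoc)

subsection \<open>Coordinatewise operators\<close>

text \<open>The operator that applies \<open>T\<close> to every coordinate; in tensor notation, \<open>I \<otimes> T\<close>.  For a
  bounded functional \<open>T\<close> it is the slice map to scalar-valued families.\<close>

definition amp ::
    "('o::complex_hilbert_space \<Rightarrow> 'p::complex_hilbert_space) \<Rightarrow> ('g, 'o) ell2 \<Rightarrow> ('g, 'p) ell2"
  where "amp T f = Abs_ell2 (\<lambda>x. T (coord f x))"

context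
  fixes T :: "'o::complex_hilbert_space \<Rightarrow> 'p::complex_hilbert_space"
  assumes T: "bounded_clinear T"
begin

lemma amp_aux:
  assumes K: "K \<ge> 0" "\<And>x. norm (T x) \<le> K * norm x" and "finite F"
  shows "L2_set (\<lambda>x. norm (T (coord f x))) F \<le> K * norm f"
proof -
  have "L2_set (\<lambda>x. norm (T (coord f x))) F \<le> L2_set (\<lambda>x. K * norm (coord f x)) F"
    by (intro L2_set_mono K) simp
  also have "\<dots> = K * L2_set (\<lambda>x. norm (coord f x)) F"
    using K(1) by (simp add: L2_set_right_distrib)
  also have "\<dots> \<le> K * norm f"
    by (intro mult_left_mono L2_set_coord_le K \<open>finite F\<close>)
  finally show ?thesis .
qed

lemma coord_amp: "coord (amp T f) x = T (coord f x)"
proof -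
  obtain K where K: "K \<ge> 0" "\<And>x. norm (T x) \<le> K * norm x"
    using bounded_clinear_bound[OF T] by blast
  have "(\<lambda>x. (norm (T (coord f x)))\<^sup>2) summable_on UNIV"
    by (rule ell2I(1)[OF amp_aux[OF K]])
  then show ?thesis by (simp add: amp_def Abs_ell2_inverse)
qed

lemma bounded_clinear_amp: "bounded_clinear (amp T :: ('g, 'o) ell2 \<Rightarrow> _)"
proof -
  obtain K where K: "K \<ge> 0" "\<And>x. norm (T x) \<le> K * norm x"
    using bounded_clinear_bound[OF T] by blast
  show ?thesis
  proof (rule bounded_clinearI[of _ K])
    show "norm (amp T f) \<le> K * norm f" for f :: "('g, 'o) ell2"
      by (rule norm_ell2_leI) (simp add: coord_amp amp_aux[OF K])
  qed (auto intro!: ell2_eqI simp: coord_amp plus_ell2.rep_eq scaleC_ell2.rep_eq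
      bounded_clinear_simps[OF T])
qed

lemma amp_tensor: "amp T (f \<otimes> h) = f \<otimes> T h"
  by (rule ell2_eqI) (simp add: coord_amp tensor.rep_eq bounded_clinear_simps[OF T])

lemma amp_ltrans: "amp T (ltrans g f) = ltrans g (amp T f)"
  by (rule ell2_eqI) (simp add: coord_amp ltrans.rep_eq)

end

lemma cadjoint_amp:
  assumes "bounded_clinear T"
  shows "cadjoint (amp T) = amp (cadjoint T)"
  by (rule cadjoint_eqI)
    (simp_all add: assms bounded_clinear_cadjoint bounded_clinear_amp cinner_ell2.rep_eq coord_amp
      cadjoint_right)

subsection \<open>Tensor products of bounded operators\<close>

lemma op_tensor_eqI:
  assumes "bounded_clinear R" "\<And>f h. R (f \<otimes> h) = S f \<otimes> T h"
  shows "S \<otimes>\<^sub>o\<^sub>p T = R"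
  unfolding op_tensor_def
proof (rule the_equality)
  fix Q assume "bounded_clinear Q \<and> (\<forall>f h. Q (f \<otimes> h) = S f \<otimes> T h)"
  then show "Q = R" using assms by (intro ell2_operator_eqI) auto
qed (use assms in blast)

lemma norm_sq_sum_chi_tensor:
  assumes "finite F"
  shows "(norm (\<Sum>x\<in>F. chi x \<otimes> u x))\<^sup>2 = (\<Sum>x\<in>F. (norm (u x))\<^sup>2)"
proof -
  have "(\<Sum>\<^sub>\<infinity>y. (norm (coord (\<Sum>x\<in>F. chi x \<otimes> u x) y))\<^sup>2) = (\<Sum>\<^sub>\<infinity>y\<in>F. (norm (u y))\<^sup>2)"
    by (rule infsum_cong_neutral) (auto simp: coord_sum_chi assms)
  also have "\<dots> = (\<Sum>x\<in>F. (norm (u x))\<^sup>2)"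
    using assms by (rule infsum_finite)
  finally show ?thesis by (simp add: norm_ell2.rep_eq sum_nonneg)
qed

text \<open>The bound that makes \<open>S \<otimes> I\<close> bounded.  The induction is the Gram-Schmidt process: splitting
  off the direction of one of the vectors \<open>h t\<close> leaves a family, orthogonal to that direction, with one
  non-zero vector fewer.\<close>

lemma norm_sum_image_chi_tensor_le:
  fixes h :: "'g \<Rightarrow> 'o::complex_hilbert_space"
  assumes S: "bounded_clinear S" and C: "C \<ge> 0" "\<And>f. norm (S f) \<le> C * norm f" and "finite F"
  shows "(norm (\<Sum>t\<in>F. S (chi t) \<otimes> h t))\<^sup>2 \<le> C\<^sup>2 * (\<Sum>t\<in>F. (norm (h t))\<^sup>2)"
  using \<open>finite F\<close>
proof (induction F arbitrary: h)
  case empty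
  then show ?case by simp
next
  case (insert t F)
  note tensor_right = bounded_clinear_simps[OF bounded_clinear_tensor_right]
  show ?case
  proof (cases "h t = 0")
    case True
    then show ?thesis using insert by (simp add: tensor_right)
  next
    case False
    define e where "e = sgn (h t)"
    define u where "u s = cinner (h s) e" for s
    define h' where "h' s = h s - u s *\<^sub>C e" for s
    have "norm e = 1" using False by (simp add: e_def norm_sgn)
    then have ee: "cinner e e = 1" by (simp add: cinner_self_norm)
    have h'_e: "cinner (h' s) e = 0" for s
      by (simp add: h'_def cinner_diff_left cinner_scaleC_left ee u_def)
    have "h t = norm (h t) *\<^sub>R e" using False by (simp add: e_def sgn_div_norm)
    moreover from this have "u t = norm (h t)"
      unfolding u_def by (metis cinner_scaleR_left ee mult.right_neutral)
    ultimately have "h' t = 0" by (simp add: h'_def scaleR_scaleC)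
    have h_eq: "h s = h' s + u s *\<^sub>C e" for s by (simp add: h'_def)
    have norm_h: "(norm (h s))\<^sup>2 = (norm (h' s))\<^sup>2 + (norm (u s))\<^sup>2" for s
      unfolding h_eq[of s] by (subst norm_sq_add)
        (simp add: cinner_scaleC_right h'_e norm_scaleC \<open>norm e = 1\<close>)
    define v where "v = (\<Sum>s\<in>insert t F. chi s \<otimes> u s)"
    define w where "w = (\<Sum>s\<in>F. S (chi s) \<otimes> h' s)"
    have "S v \<otimes> e = (\<Sum>s\<in>insert t F. S (chi s) \<otimes> (u s *\<^sub>C e))"
      unfolding v_def tensor_complex
      by (simp add: linear_sum[OF bounded_linear.linear[OF bounded_clinear_bounded_linear[OF
            bounded_clinear_compose[OF bounded_clinear_tensor_left S, unfolded o_def]]]]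
          bounded_clinear_simps[OF S] bounded_clinear_simps[OF bounded_clinear_tensor_left] tensor_right)
    moreover have "w = (\<Sum>s\<in>insert t F. S (chi s) \<otimes> h' s)"
      using insert.hyps by (simp add: w_def \<open>h' t = 0\<close> tensor_right)
    ultimately have split: "(\<Sum>s\<in>insert t F. S (chi s) \<otimes> h s) = w + S v \<otimes> e"
      by (simp only: sum.distrib[symmetric] h_eq[symmetric] tensor_right(1)[symmetric])
    have "cinner w (S v \<otimes> e) = (\<Sum>s\<in>F. cinner (S (chi s) \<otimes> h' s) (S v \<otimes> e))"
      unfolding w_def
      by (rule linear_sum[OF bounded_linear.linear[OF bounded_linear_cinner_left]])
    then have "cinner w (S v \<otimes> e) = 0" by (simp add: cinner_tensor h'_e)
    then have "(norm (w + S v \<otimes> e))\<^sup>2 = (norm w)\<^sup>2 + (norm (S v))\<^sup>2"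
      by (simp add: norm_sq_add norm_tensor \<open>norm e = 1\<close>)
    also have "(norm w)\<^sup>2 \<le> C\<^sup>2 * (\<Sum>s\<in>F. (norm (h' s))\<^sup>2)"
      unfolding w_def by (rule insert.IH)
    also have "(\<Sum>s\<in>F. (norm (h' s))\<^sup>2) = (\<Sum>s\<in>insert t F. (norm (h' s))\<^sup>2)"
      using insert.hyps by (simp add: \<open>h' t = 0\<close>)
    also have "(norm (S v))\<^sup>2 \<le> (C * norm v)\<^sup>2"
      by (intro power_mono C norm_ge_zero)
    also have "\<dots> = C\<^sup>2 * (\<Sum>s\<in>insert t F. (norm (u s))\<^sup>2)"
      unfolding v_def power_mult_distrib
      by (subst norm_sq_sum_chi_tensor) (use insert.hyps in simp_all)
    finally show ?thesis
      unfolding split norm_h sum.distrib by (simp add: distrib_left)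
  qed
qed

text \<open>Unconditional convergence without absolute convergence: the hypothesis is satisfied by families
  such as \<open>\<lambda>x. chi x \<otimes> u x\<close>, whose norms are only square-summable.\<close>

lemma summable_on_norm_square_bound:
  fixes a :: "'i \<Rightarrow> 'b::banach" and b :: "'i \<Rightarrow> real"
  assumes b: "b summable_on UNIV" and b0: "\<And>x. b x \<ge> 0"
    and ab: "\<And>F. finite F \<Longrightarrow> (norm (sum a F))\<^sup>2 \<le> sum b F"
  shows "a summable_on UNIV" "(norm (infsum a UNIV))\<^sup>2 \<le> infsum b UNIV"
proof -
  have small: "\<exists>F0. finite F0 \<and> (\<forall>F. finite F \<longrightarrow> F0 \<subseteq> F \<longrightarrow> norm (sum a F - sum a F0) < e)"
    if "e > 0" for e
  proof -
    have "e\<^sup>2 > 0" using \<open>e > 0\<close> by simp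
    with tendstoD[OF has_sum_infsum[OF b, unfolded has_sum_def]]
    obtain F0 where F0: "finite F0"
        "\<And>F. finite F \<Longrightarrow> F0 \<subseteq> F \<Longrightarrow> dist (sum b F) (infsum b UNIV) < e\<^sup>2"
      unfolding eventually_finite_subsets_at_top by (metis subset_UNIV)
    have "norm (sum a F - sum a F0) < e" if F: "finite F" "F0 \<subseteq> F" for F
    proof -
      have "(norm (sum a F - sum a F0))\<^sup>2 \<le> sum b (F - F0)"
        using ab[of "F - F0"] F by (simp add: sum_diff F0)
      also have "\<dots> = sum b F - sum b F0" using F by (simp add: sum_diff F0)
      also have "\<dots> < e\<^sup>2"
        using F0(2)[of F0] F0(1) finite_sum_le_infsum[OF b \<open>finite F\<close>] b0
        by (auto simp: dist_real_def)
      finally show ?thesis using \<open>e > 0\<close> by (simp add: power2_less_imp_less)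
    qed
    then show ?thesis using F0(1) by blast
  qed
  have "cauchy_filter (filtermap (sum a) (finite_subsets_at_top UNIV))"
    unfolding cauchy_filter_metric_filtermap
  proof (intro allI impI)
    fix e :: real assume "e > 0"
    then obtain F0 where F0: "finite F0"
        "\<And>F. finite F \<Longrightarrow> F0 \<subseteq> F \<Longrightarrow> norm (sum a F - sum a F0) < e / 2"
      using small[of "e / 2"] by auto
    have "dist (sum a F) (sum a F') < e"
      if "finite F \<and> F0 \<subseteq> F" "finite F' \<and> F0 \<subseteq> F'" for F F'
      using that F0(2)[of F] F0(2)[of F'] dist_triangle_half_l[of "sum a F" "sum a F0" e "sum a F'"]
      by (simp add: dist_norm)
    then show "\<exists>P. eventually P (finite_subsets_at_top UNIV) \<and>
        (\<forall>F F'. P F \<and> P F' \<longrightarrow> dist (sum a F) (sum a F') < e)"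
      using F0(1)
      by (intro exI[of _ "\<lambda>F. finite F \<and> F0 \<subseteq> F"]) (auto simp: eventually_finite_subsets_at_top)
  qed
  moreover have "complete (UNIV::'b set)"
    by (meson Cauchy_convergent UNIV_I complete_def convergent_def)
  ultimately obtain L where "(sum a \<longlongrightarrow> L) (finite_subsets_at_top UNIV)"
    using complete_uniform[where S=UNIV] by (force simp add: filterlim_def)
  then show a: "a summable_on UNIV"
    using summable_on_def has_sum_def by blast
  show "(norm (infsum a UNIV))\<^sup>2 \<le> infsum b UNIV"
  proof (rule tendsto_upperbound)
    show "((\<lambda>F. (norm (sum a F))\<^sup>2) \<longlongrightarrow> (norm (infsum a UNIV))\<^sup>2) (finite_subsets_at_top UNIV)"
      using has_sum_infsum[OF a] unfolding has_sum_def by (intro tendsto_intros)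
    show "\<forall>\<^sub>F F in finite_subsets_at_top UNIV. (norm (sum a F))\<^sup>2 \<le> infsum b UNIV"
      by (rule eventually_finite_subsets_at_top_weakI)
        (use order_trans[OF ab finite_sum_le_infsum[OF b]] b0 in simp)
  qed simp
qed

lemma left_amplification_exists:
  fixes S :: "('g, complex) ell2 \<Rightarrow> ('g, complex) ell2"
  assumes S: "bounded_clinear S"
  obtains R :: "('g, 'o::complex_hilbert_space) ell2 \<Rightarrow> ('g, 'o) ell2"
    where "bounded_clinear R" "\<And>f h. R (f \<otimes> h) = S f \<otimes> h"
proof -
  obtain C where C: "C \<ge> 0" "\<And>f. norm (S f) \<le> C * norm f"
    using bounded_clinear_bound[OF S] by blast
  \<comment> \<open>\<open>S \<otimes> I\<close> is defined by applying \<open>S\<close> to the expansion \<open>f = \<Sum> chi t \<otimes> coord f t\<close>.\<close>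
  define a where "a f t = S (chi t) \<otimes> coord f t" for f :: "('g, 'o) ell2" and t
  define R where "R f = infsum (a f) UNIV" for f
  have sq: "(\<lambda>t. (norm (coord f t))\<^sup>2) summable_on UNIV" for f :: "('g, 'o) ell2"
    using coord[of f] by simp
  have bound: "(norm (sum (a f) F))\<^sup>2 \<le> (\<Sum>t\<in>F. C\<^sup>2 * (norm (coord f t))\<^sup>2)" if "finite F" for f F
    using norm_sum_image_chi_tensor_le[OF S C that, of "coord f"]
    by (simp add: a_def sum_distrib_left)
  have sum_a: "a f summable_on UNIV"
    and R_le: "(norm (R f))\<^sup>2 \<le> (\<Sum>\<^sub>\<infinity>t. C\<^sup>2 * (norm (coord f t))\<^sup>2)" for f
    using summable_on_norm_square_bound[OF summable_on_cmult_right[OF sq] _ bound]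
    by (auto simp: R_def)
  note tensor_right = bounded_clinear_simps[OF bounded_clinear_tensor_right]
  have "bounded_clinear R"
  proof (rule bounded_clinearI[of _ C])
    fix f g c
    have "a (f + g) = (\<lambda>t. a f t + a g t)"
      by (simp add: fun_eq_iff a_def plus_ell2.rep_eq tensor_right)
    then show "R (f + g) = R f + R g"
      by (simp add: R_def infsum_add sum_a)
    from infsumI[OF has_sum_bounded_linear[OF bounded_linear_scaleC has_sum_infsum[OF sum_a]]]
    have "(\<Sum>\<^sub>\<infinity>t. c *\<^sub>C a f t) = c *\<^sub>C R f" by (simp add: R_def)
    moreover have "a (c *\<^sub>C f) = (\<lambda>t. c *\<^sub>C a f t)"
      by (simp add: fun_eq_iff a_def scaleC_ell2.rep_eq tensor_right)
    ultimately show "R (c *\<^sub>C f) = c *\<^sub>C R f"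
      by (simp add: R_def)
    have "(norm f)\<^sup>2 = (\<Sum>\<^sub>\<infinity>t. (norm (coord f t))\<^sup>2)"
      by (simp add: norm_ell2.rep_eq infsum_nonneg)
    then have "(norm (R f))\<^sup>2 \<le> (C * norm f)\<^sup>2"
      using R_le[of f] by (simp add: infsum_cmult_right' power_mult_distrib)
    then show "norm (R f) \<le> C * norm f"
      by (rule power2_le_imp_le) (use C(1) in simp)
  qed
  moreover have "R (f \<otimes> h) = S f \<otimes> h" for f :: "('g, complex) ell2" and h :: 'o
  proof -
    have "bounded_linear (\<lambda>f. S f \<otimes> h)"
      by (rule bounded_clinear_bounded_linear[OF
            bounded_clinear_compose[OF bounded_clinear_tensor_left S, unfolded o_def]])
    from infsumI[OF has_sum_bounded_linear[OF this has_sum_chi_tensor]]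
    have "(\<Sum>\<^sub>\<infinity>t. S (chi t \<otimes> coord f t) \<otimes> h) = S f \<otimes> h" .
    moreover have "S (chi t \<otimes> coord f t) \<otimes> h = a (f \<otimes> h) t" for t
      by (simp add: a_def tensor_complex bounded_clinear_simps[OF S] tensor.rep_eq tensor_right
          bounded_clinear_simps[OF bounded_clinear_tensor_left])
    ultimately show ?thesis by (simp add: R_def)
  qed
  ultimately show ?thesis by (rule that)
qed

lemma
  fixes S :: "('g, complex) ell2 \<Rightarrow> ('g, complex) ell2" and T :: "'o::complex_hilbert_space \<Rightarrow> 'o"
  assumes "bounded_clinear S" "bounded_clinear T"
  shows bounded_clinear_op_tensor: "bounded_clinear (S \<otimes>\<^sub>o\<^sub>p T)"
    and op_tensor_tensor: "(S \<otimes>\<^sub>o\<^sub>p T) (f \<otimes> h) = S f \<otimes> T h"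
proof -
  obtain R :: "('g, 'o) ell2 \<Rightarrow> ('g, 'o) ell2" where R: "bounded_clinear R" "\<And>f h. R (f \<otimes> h) = S f \<otimes> h"
    using left_amplification_exists[OF assms(1)] by blast
  then have "S \<otimes>\<^sub>o\<^sub>p T = R \<circ> amp T"
    by (intro op_tensor_eqI) (simp_all add: assms bounded_clinear_compose bounded_clinear_amp amp_tensor)
  then show "bounded_clinear (S \<otimes>\<^sub>o\<^sub>p T)" "(S \<otimes>\<^sub>o\<^sub>p T) (f \<otimes> h) = S f \<otimes> T h"
    by (simp_all add: R assms bounded_clinear_compose bounded_clinear_amp amp_tensor)
qed

lemma op_tensor_id_left: "bounded_clinear T \<Longrightarrow> id \<otimes>\<^sub>o\<^sub>p T = amp T"
  by (rule op_tensor_eqI) (simp_all add: bounded_clinear_amp amp_tensor)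

subsection \<open>The commutation theorem\<close>

text \<open>In terms of the matrix entries \<open>X\<^sub>s\<^sub>,\<^sub>r h = coord (X (chi r \<otimes> h)) s\<close>, the hypotheses say that
  \<open>X\<^sub>s\<^sub>,\<^sub>r\<close> depends only on \<open>- s + r\<close>, that \<open>Y\<^sub>s\<^sub>,\<^sub>r\<close> depends only on \<open>s - r\<close>, and that the entries of
  \<open>X\<close> commute with those of \<open>Y\<close>.  The two matrix products therefore have the same terms, up to the
  substitution \<open>r \<mapsto> s - r + t\<close>.\<close>

theorem translation_commutation:
  fixes X Y :: "('g::group_add, 'o::complex_hilbert_space) ell2 \<Rightarrow> ('g, 'o) ell2"
  assumes X: "bounded_clinear X" "\<And>g f. X (ltrans g f) = ltrans g (X f)"
    and Y: "bounded_clinear Y" "\<And>g f. Y (rtrans g f) = rtrans g (Y f)"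
    and Y_amp: "\<And>T f. bounded_clinear T \<Longrightarrow> Y (amp T f) = amp T (Y f)"
  shows "X \<circ> Y = Y \<circ> X"
proof (rule ell2_operator_eqI)
  fix t :: 'g and h :: 'o
  define x where "x s r h = coord (X (chi r \<otimes> h)) s" for s r h
  define y where "y s r h = coord (Y (chi r \<otimes> h)) s" for s r h
  have x_shift: "x (g + s) (g + r) h = x s r h" for g s r h
    using X(2)[of g "chi r \<otimes> h"]
    by (simp add: x_def ltrans_chi_tensor ltrans.rep_eq add.assoc[symmetric])
  have y_shift: "y (s - g) (r - g) h = y s r h" for g s r h
    using Y(2)[of g "chi r \<otimes> h"]
    by (simp add: y_def rtrans_chi_tensor rtrans.rep_eq)
  have x_bdd: "bounded_clinear (x s r)" for s r
    using bounded_clinear_compose[OF bounded_clinear_compose[OF bounded_clinear_coord X(1)]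
        bounded_clinear_tensor_right]
    by (simp add: x_def[abs_def] o_def)
  have xy: "x s r (y s' r' h) = y s' r' (x s r h)" for s r s' r' h
    using Y_amp[OF x_bdd, of s r "chi r' \<otimes> h"]
    by (simp add: y_def amp_tensor x_bdd coord_amp)
  have entry: "((\<lambda>r. coord (Z (chi r \<otimes> coord v r)) s) has_sum coord (Z v) s) UNIV"
    if "bounded_clinear Z" for Z :: "('g, 'o) ell2 \<Rightarrow> ('g, 'o) ell2" and v s
    using has_sum_bounded_linear[OF bounded_clinear_bounded_linear[OF
          bounded_clinear_compose[OF bounded_clinear_coord that]] has_sum_chi_tensor]
    by (simp add: o_def)
  have "coord (X (Y (chi t \<otimes> h))) s = coord (Y (X (chi t \<otimes> h))) s" for s
  proof -
    have XY: "((\<lambda>r. x s r (y r t h)) has_sum coord (X (Y (chi t \<otimes> h))) s) UNIV"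
      using entry[OF X(1)] by (simp add: x_def y_def)
    have YX: "((\<lambda>r. y s r (x r t h)) has_sum coord (Y (X (chi t \<otimes> h))) s) UNIV"
      using entry[OF Y(1)] by (simp add: x_def y_def)
    have "x s (s - r + t) (y (s - r + t) t h) = y s r (x r t h)" for r
    proof -
      have "x s (s - r + t) = x r t"
        using x_shift[of "s - r" r t] by (simp add: fun_eq_iff)
      moreover have "y (s - r + t) t = y s r"
        using y_shift[of s "- t + r" r]
        by (simp add: fun_eq_iff diff_conv_add_uminus minus_add add.assoc del: add_uminus_conv_diff)
      ultimately show ?thesis by (simp add: xy)
    qed
    moreover have "bij (\<lambda>r. s - r + t)"
      by (rule bij_betw_byWitness[of _ "\<lambda>q. t - q + s"]) 
         (auto simp: diff_conv_add_uminus add.assoc minus_add simp del: add_uminus_conv_diff)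
    ultimately have "((\<lambda>r. y s r (x r t h)) has_sum coord (X (Y (chi t \<otimes> h))) s) UNIV"
      using XY has_sum_reindex_bij_betw[of "\<lambda>r. s - r + t" UNIV UNIV "\<lambda>r. x s r (y r t h)"] by simp
    with YX show ?thesis by (metis has_sum_unique)
  qed
  then show "(X \<circ> Y) (chi t \<otimes> h) = (Y \<circ> X) (chi t \<otimes> h)"
    by (auto intro: ell2_eqI)
qed (simp_all add: X Y bounded_clinear_compose)

section \<open>The group von Neumann algebra and its amplification\<close>

lemma von_neumann_algebra_commutant:
  assumes "\<And>T. T \<in> N \<Longrightarrow> bounded_clinear T \<and> cadjoint T \<in> N"
  shows "von_neumann_algebra (commutant N)"
  unfolding von_neumann_algebra_def
proof (intro conjI ballI)
  fix T assume T: "T \<in> commutant N"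
  then show bT: "bounded_clinear T" by (simp add: commutant_def)
  have "cadjoint T \<circ> R = R \<circ> cadjoint T" if R: "R \<in> N" for R
  proof -
    have bR: "bounded_clinear R" using assms R by blast
    have "T \<circ> cadjoint R = cadjoint R \<circ> T"
      using T assms R by (simp add: commutant_def)
    then have "cadjoint (T \<circ> cadjoint R) = cadjoint (cadjoint R \<circ> T)" by simp
    then show ?thesis
      by (simp add: cadjoint_compose cadjoint_cadjoint bT bR bounded_clinear_cadjoint)
  qed
  then show "cadjoint T \<in> commutant N"
    by (simp add: commutant_def bT bounded_clinear_cadjoint)
next
  have "N \<subseteq> commutant (commutant N)"
    using assms by (auto simp: commutant_def)
  then show "commutant (commutant (commutant N)) = commutant N"
    by (auto simp: commutant_def)
qed

lemma vN_generated_subset: "von_neumann_algebra M \<Longrightarrow> S \<subseteq> M \<Longrightarrow> vN_generated S \<subseteq> M"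
  by (auto simp: vN_generated_def)

lemma vN_generated_superset: "S \<subseteq> vN_generated S"
  by (auto simp: vN_generated_def)

text \<open>Operators in the bicommutant of \<open>S\<close> lie in the von Neumann algebra generated by \<open>S\<close>.\<close>

lemma vN_generatedI:
  assumes "bounded_clinear X"
    and "\<And>Y. bounded_clinear Y \<Longrightarrow> (\<And>R. R \<in> S \<Longrightarrow> Y \<circ> R = R \<circ> Y) \<Longrightarrow> X \<circ> Y = Y \<circ> X"
  shows "X \<in> vN_generated S"
  unfolding vN_generated_def
proof clarify
  fix M assume "von_neumann_algebra M" "S \<subseteq> M"
  then have "commutant (commutant M) = M" by (simp add: von_neumann_algebra_def)
  moreover have "X \<in> commutant (commutant M)"
    using assms \<open>S \<subseteq> M\<close> by (auto simp: commutant_def subset_iff)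
  ultimately show "X \<in> M" by simp
qed

lemma von_neumann_algebra_commutant_ltrans: "von_neumann_algebra (commutant (range ltrans))"
  by (rule von_neumann_algebra_commutant) (auto simp: bounded_clinear_ltrans cadjoint_ltrans)

lemma commutant_rangeD: "X \<in> commutant (range R) \<Longrightarrow> X (R g f) = R g (X f)"
  by (auto simp: commutant_def fun_eq_iff)

lemma commutant_bounded_clinear: "X \<in> commutant S \<Longrightarrow> bounded_clinear X"
  by (simp add: commutant_def)

theorem right_group_vN_eq_commutant:
  "\<R> = commutant (range (ltrans :: 'g::group_add \<Rightarrow> ('g, complex) ell2 \<Rightarrow> _))"
proof
  show "\<R> \<subseteq> commutant (range (ltrans :: 'g \<Rightarrow> ('g, complex) ell2 \<Rightarrow> _))"
    unfolding right_group_vN_def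
    by (rule vN_generated_subset[OF von_neumann_algebra_commutant_ltrans])
      (auto simp: commutant_def right_regular_eq_rtrans bounded_clinear_rtrans ltrans_rtrans fun_eq_iff)
next
  show "commutant (range ltrans) \<subseteq> (\<R> :: (('g, complex) ell2 \<Rightarrow> _) set)"
  proof
    fix X :: "('g, complex) ell2 \<Rightarrow> ('g, complex) ell2"
    assume X: "X \<in> commutant (range ltrans)"
    show "X \<in> \<R>"
      unfolding right_group_vN_def
    proof (rule vN_generatedI)
      fix Y :: "('g, complex) ell2 \<Rightarrow> ('g, complex) ell2"
      assume Y: "bounded_clinear Y" and "\<And>R. R \<in> range right_regular \<Longrightarrow> Y \<circ> R = R \<circ> Y"
      then have Y_rtrans: "Y (rtrans g f) = rtrans g (Y f)" for g f
        by (auto simp: right_regular_eq_rtrans fun_eq_iff)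
      \<comment> \<open>On scalar-valued families a coordinatewise operator is multiplication by a scalar.\<close>
      have "Y (amp T f) = amp T (Y f)" if T: "bounded_clinear T" for T f
      proof -
        have "T z = T 1 * z" for z
          using bounded_clinear_scaleC[OF T, of z 1] by (simp add: scaleC_complex_def mult.commute)
        then have "amp T f' = T 1 *\<^sub>C f'" for f' :: "('g, complex) ell2"
          by (intro ell2_eqI)
            (metis coord_amp[OF T] scaleC_complex_def scaleC_ell2.rep_eq)
        then show ?thesis by (simp add: bounded_clinear_scaleC[OF Y])
      qed
      then show "X \<circ> Y = Y \<circ> X"
        using X Y Y_rtrans
        by (intro translation_commutation) (auto dest: commutant_rangeD commutant_bounded_clinear)
    qed (use X in \<open>simp add: commutant_def\<close>)
  qed
qed

lemma id_in_right_group_vN: "id \<in> \<R>"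
  by (simp add: right_group_vN_eq_commutant commutant_def bounded_clinear_id)

lemma op_tensor_ltrans:
  assumes S: "bounded_clinear S" "\<And>f. S (ltrans g f) = ltrans g (S f)" and T: "bounded_clinear T"
  shows "(S \<otimes>\<^sub>o\<^sub>p T) (ltrans g f) = ltrans g ((S \<otimes>\<^sub>o\<^sub>p T) f)"
proof -
  have "(S \<otimes>\<^sub>o\<^sub>p T) \<circ> ltrans g = ltrans g \<circ> (S \<otimes>\<^sub>o\<^sub>p T)"
    by (rule ell2_operator_eqI)
      (simp_all add: S T bounded_clinear_compose bounded_clinear_op_tensor bounded_clinear_ltrans
        ltrans_tensor op_tensor_tensor)
  then show ?thesis by (simp add: fun_eq_iff)
qed

theorem vN_tensor_eq_commutant:
  "\<R> \<otimes>\<^sub>v\<^sub>N {T :: 'o::complex_hilbert_space \<Rightarrow> 'o. bounded_clinear T}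
    = commutant (range (ltrans :: 'g::group_add \<Rightarrow> ('g, 'o) ell2 \<Rightarrow> _))"
proof
  show "\<R> \<otimes>\<^sub>v\<^sub>N {T :: 'o \<Rightarrow> 'o. bounded_clinear T}
      \<subseteq> commutant (range (ltrans :: 'g \<Rightarrow> ('g, 'o) ell2 \<Rightarrow> _))"
    unfolding vN_tensor_def
  proof (rule vN_generated_subset[OF von_neumann_algebra_commutant_ltrans], clarify)
    fix S and T :: "'o \<Rightarrow> 'o"
    assume "S \<in> \<R>" and T: "bounded_clinear T"
    then have "S \<in> commutant (range ltrans)" by (simp add: right_group_vN_eq_commutant)
    then have "bounded_clinear S" "\<And>g f. S (ltrans g f) = ltrans g (S f)"
      by (auto dest: commutant_rangeD commutant_bounded_clinear)
    then show "S \<otimes>\<^sub>o\<^sub>p T \<in> commutant (range ltrans)"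
      using T by (auto simp: commutant_def bounded_clinear_op_tensor op_tensor_ltrans fun_eq_iff)
  qed
next
  show "commutant (range ltrans) \<subseteq>
      (\<R> \<otimes>\<^sub>v\<^sub>N {T. bounded_clinear T} :: (('g, 'o) ell2 \<Rightarrow> _) set)"
  proof
    fix X :: "('g, 'o) ell2 \<Rightarrow> ('g, 'o) ell2"
    assume X: "X \<in> commutant (range ltrans)"
    show "X \<in> \<R> \<otimes>\<^sub>v\<^sub>N {T. bounded_clinear T}"
      unfolding vN_tensor_def
    proof (rule vN_generatedI)
      fix Y :: "('g, 'o) ell2 \<Rightarrow> ('g, 'o) ell2"
      assume Y: "bounded_clinear Y"
        and "\<And>R. R \<in> {S \<otimes>\<^sub>o\<^sub>p T | S T. S \<in> \<R> \<and> T \<in> {T. bounded_clinear T}} \<Longrightarrow> Y \<circ> R = R \<circ> Y"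
      then have comm: "Y \<circ> (S \<otimes>\<^sub>o\<^sub>p T) = (S \<otimes>\<^sub>o\<^sub>p T) \<circ> Y" if "S \<in> \<R>" "bounded_clinear T" for S T
        using that by blast
      have "Y (rtrans g f) = rtrans g (Y f)" for g f
      proof -
        have "right_regular g \<otimes>\<^sub>o\<^sub>p id = (rtrans g :: ('g, 'o) ell2 \<Rightarrow> _)"
          by (rule op_tensor_eqI)
            (simp_all add: right_regular_eq_rtrans bounded_clinear_rtrans rtrans_tensor)
        moreover have "right_regular g \<in> \<R>"
          unfolding right_group_vN_def by (rule subsetD[OF vN_generated_superset rangeI])
        ultimately have "Y \<circ> rtrans g = rtrans g \<circ> Y"
          using comm[OF _ bounded_clinear_id, of "right_regular g"] by simp
        then show ?thesis by (simp add: fun_eq_iff)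
      qed
      moreover have "Y (amp T f) = amp T (Y f)" if T: "bounded_clinear T" for T f
      proof -
        have "Y \<circ> amp T = amp T \<circ> Y"
          using comm[OF id_in_right_group_vN T] by (simp add: op_tensor_id_left[OF T])
        then show ?thesis by (simp add: fun_eq_iff)
      qed
      ultimately show "X \<circ> Y = Y \<circ> X"
        using X Y by (intro translation_commutation)
          (auto dest: commutant_rangeD commutant_bounded_clinear)
    qed (use X in \<open>simp add: commutant_def\<close>)
  qed
qed

subsection \<open>Amplifications of operators on scalar families\<close>

lemma chi_tensor_one: "chi x \<otimes> (1::complex) = chi x"
  by (simp add: tensor_complex scaleC_one)

lemma cinner_chi: "cinner f (chi x) = coord f x"
  using cinner_chi_tensor[of f x 1] by (simp add: chi_tensor_one cinner_complex_def)

context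
  fixes S :: "('g, complex) ell2 \<Rightarrow> ('g, complex) ell2"
  assumes S: "bounded_clinear S"
begin

lemma amp_op_tensor_id_functional:
  fixes \<phi> :: "'o::complex_hilbert_space \<Rightarrow> complex"
  assumes \<phi>: "bounded_clinear \<phi>"
  shows "amp \<phi> ((S \<otimes>\<^sub>o\<^sub>p id) f) = S (amp \<phi> f)"
proof -
  have "amp \<phi> \<circ> (S \<otimes>\<^sub>o\<^sub>p id) = S \<circ> amp \<phi>"
    by (rule ell2_operator_eqI)
      (simp_all add: S \<phi> bounded_clinear_id bounded_clinear_compose bounded_clinear_op_tensor
        bounded_clinear_amp amp_tensor op_tensor_tensor tensor_complex bounded_clinear_scaleC[OF S])
  then show ?thesis by (simp add: fun_eq_iff)
qed

lemma op_tensor_id_amp: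
  assumes T: "bounded_clinear T"
  shows "(S \<otimes>\<^sub>o\<^sub>p id) (amp T f) = amp T ((S \<otimes>\<^sub>o\<^sub>p id) f)"
proof -
  have "(S \<otimes>\<^sub>o\<^sub>p id) \<circ> amp T = amp T \<circ> (S \<otimes>\<^sub>o\<^sub>p id)"
    by (rule ell2_operator_eqI)
      (simp_all add: S T bounded_clinear_id bounded_clinear_compose bounded_clinear_op_tensor
        bounded_clinear_amp amp_tensor op_tensor_tensor)
  then show ?thesis by (simp add: fun_eq_iff)
qed

lemma cadjoint_op_tensor_id:
  "cadjoint (S \<otimes>\<^sub>o\<^sub>p id) = cadjoint S \<otimes>\<^sub>o\<^sub>p (id :: 'o::complex_hilbert_space \<Rightarrow> 'o)"
proof (rule op_tensor_eqI[symmetric])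
  have b: "bounded_clinear (S \<otimes>\<^sub>o\<^sub>p (id :: 'o \<Rightarrow> 'o))"
    by (simp add: S bounded_clinear_op_tensor bounded_clinear_id)
  then show "bounded_clinear (cadjoint (S \<otimes>\<^sub>o\<^sub>p (id :: 'o \<Rightarrow> 'o)))"
    by (rule bounded_clinear_cadjoint)
  fix f and h :: 'o
  have "cinner (cadjoint (S \<otimes>\<^sub>o\<^sub>p id) (f \<otimes> h)) (chi y \<otimes> k) = cinner (cadjoint S f \<otimes> h) (chi y \<otimes> k)"
    for y k
    by (simp add: cadjoint_left b op_tensor_tensor S bounded_clinear_id cinner_tensor)
  then show "cadjoint (S \<otimes>\<^sub>o\<^sub>p id) (f \<otimes> h) = cadjoint S f \<otimes> id h"
    by (metis cinner_chi_tensor cinner_extI ell2_eqI id_apply)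
qed

end

lemma op_tensor_id_rtrans:
  fixes f :: "('g::group_add, 'o::complex_hilbert_space) ell2"
  assumes S: "bounded_clinear S" and "\<And>f. S (rtrans g f) = rtrans g (S f)"
  shows "(S \<otimes>\<^sub>o\<^sub>p id) (rtrans g f) = rtrans g ((S \<otimes>\<^sub>o\<^sub>p id) f)"
proof -
  have "(S \<otimes>\<^sub>o\<^sub>p (id :: 'o \<Rightarrow> 'o)) \<circ> rtrans g = rtrans g \<circ> (S \<otimes>\<^sub>o\<^sub>p id)"
    by (rule ell2_operator_eqI)
      (simp_all add: S assms bounded_clinear_id bounded_clinear_compose bounded_clinear_op_tensor
        bounded_clinear_rtrans rtrans_tensor op_tensor_tensor)
  then show ?thesis by (simp add: fun_eq_iff)
qed

lemma op_tensor_id_compose: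
  assumes "bounded_clinear S" "bounded_clinear S'"
  shows "(S \<otimes>\<^sub>o\<^sub>p id) \<circ> (S' \<otimes>\<^sub>o\<^sub>p id) = (S \<circ> S') \<otimes>\<^sub>o\<^sub>p id"
  by (rule op_tensor_eqI[symmetric])
    (simp_all add: assms bounded_clinear_compose bounded_clinear_op_tensor bounded_clinear_id
      op_tensor_tensor)

lemma unitary_op_tensor_id:
  assumes "unitary S"
  shows "unitary (S \<otimes>\<^sub>o\<^sub>p (id :: 'o::complex_hilbert_space \<Rightarrow> 'o))"
proof -
  have S: "bounded_clinear S" "bounded_clinear (cadjoint S)"
    using assms by (simp_all add: unitary_bounded_clinear bounded_clinear_cadjoint)
  have "id \<otimes>\<^sub>o\<^sub>p (id :: 'o \<Rightarrow> 'o) = id"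
    by (rule op_tensor_eqI) (simp_all add: bounded_clinear_id)
  then show ?thesis
    using assms by (simp add: unitary_def cadjoint_op_tensor_id op_tensor_id_compose S
        bounded_clinear_op_tensor bounded_clinear_id)
qed

subsection \<open>The conjugation that exchanges left and right translations\<close>

text \<open>The conjugate-linear isometric involution \<open>f \<mapsto> (x \<mapsto> cnj (f (- x)))\<close>, the modular conjugation of the
  group von Neumann algebra.\<close>

lift_definition flip :: "('g::group_add, complex) ell2 \<Rightarrow> ('g, complex) ell2"
  is "\<lambda>f x. cnj (f (- x))"
proof -
  fix f :: "'g \<Rightarrow> complex"
  assume "(\<lambda>x. (norm (f x))\<^sup>2) summable_on UNIV"
  moreover have "bij (uminus :: 'g \<Rightarrow> 'g)" by (rule bij_uminus)
  ultimately show "(\<lambda>x. (norm (cnj (f (- x))))\<^sup>2) summable_on UNIV"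
    using summable_on_reindex_bij_betw[of uminus UNIV UNIV "\<lambda>x. (norm (f x))\<^sup>2"] by simp
qed

lemma flip_flip [simp]: "flip (flip f) = f"
  by transfer simp

lemma cinner_flip: "cinner (flip f) f' = cinner (flip f') f"
proof -
  have "cinner (flip f) f' = (\<Sum>\<^sub>\<infinity>x. cnj (coord f (- x)) * cnj (coord f' x))"
    by (simp add: cinner_ell2.rep_eq flip.rep_eq cinner_complex_def)
  also have "\<dots> = (\<Sum>\<^sub>\<infinity>x. cnj (coord f (- (- x))) * cnj (coord f' (- x)))"
    by (rule infsum_reindex_bij_betw[symmetric, OF bij_uminus])
  also have "\<dots> = cinner (flip f') f"
    by (simp add: cinner_ell2.rep_eq flip.rep_eq cinner_complex_def mult.commute)
  finally show ?thesis .
qed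

lemma flip_ltrans: "flip (ltrans g f) = rtrans g (flip f)"
  by transfer (simp add: minus_add)

lemma flip_rtrans: "flip (rtrans g f) = ltrans g (flip f)"
  by transfer (simp add: minus_add)

lemma norm_flip: "norm (flip f) = norm f"
proof -
  have "complex_of_real ((norm (flip f))\<^sup>2) = complex_of_real ((norm f)\<^sup>2)"
    using cinner_flip[of f "flip f"] by (simp only: cinner_self_norm[symmetric] flip_flip)
  then show ?thesis unfolding of_real_eq_iff by (simp add: power2_eq_iff_nonneg)
qed

text \<open>The transpose of an operator with respect to the bilinear pairing \<open>cinner f (flip f')\<close>.\<close>

definition flip_transpose ::
    "(('g::group_add, complex) ell2 \<Rightarrow> ('g, complex) ell2) \<Rightarrow> ('g, complex) ell2 \<Rightarrow> ('g, complex) ell2"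
  where "flip_transpose S = flip \<circ> cadjoint S \<circ> flip"

lemma bounded_clinear_flip_conj:
  assumes S: "bounded_clinear S"
  shows "bounded_clinear (flip \<circ> S \<circ> flip)"
proof -
  obtain K where K: "\<And>x. norm (S x) \<le> K * norm x"
    using bounded_clinear_bound[OF S] by blast
  have add: "flip (f + f') = flip f + flip f'" for f f' :: "('g::group_add, complex) ell2"
    by transfer simp
  have scale: "flip (c *\<^sub>C f) = cnj c *\<^sub>C flip f" for c and f :: "('g::group_add, complex) ell2"
    by transfer (simp add: scaleC_complex_def)
  have "norm ((flip \<circ> S \<circ> flip) f) \<le> K * norm f" for f
    using K[of "flip f"] by (simp add: norm_flip)
  then show ?thesis
    by (rule bounded_clinearI[rotated 2]) (simp_all add: add scale bounded_clinear_simps[OF S])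
qed

lemma cadjoint_flip_conj:
  assumes S: "bounded_clinear S"
  shows "cadjoint (flip \<circ> S \<circ> flip) = flip_transpose S"
  unfolding flip_transpose_def
proof (rule cadjoint_eqI)
  show "bounded_clinear (flip \<circ> cadjoint S \<circ> flip)"
    by (intro bounded_clinear_flip_conj bounded_clinear_cadjoint S)
  fix f f'
  have "cinner ((flip \<circ> S \<circ> flip) f) f' = cinner (cadjoint S (flip f')) (flip f)"
    by (simp add: cinner_flip cadjoint_left S)
  also have "\<dots> = cinner f ((flip \<circ> cadjoint S \<circ> flip) f')"
    using cinner_flip[of "flip (cadjoint S (flip f'))" "flip f"] by simp
  finally show "cinner ((flip \<circ> S \<circ> flip) f) f' = cinner f ((flip \<circ> cadjoint S \<circ> flip) f')" .
qed

lemma cadjoint_flip_transpose: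
  assumes "bounded_clinear S"
  shows "cadjoint (flip_transpose S) = flip \<circ> S \<circ> flip"
  using cadjoint_flip_conj[OF bounded_clinear_cadjoint[OF assms]]
  by (simp add: flip_transpose_def cadjoint_cadjoint assms)

lemma flip_transpose_flip_transpose:
  assumes "bounded_clinear S"
  shows "flip_transpose (flip_transpose S) = S"
  unfolding flip_transpose_def[of "flip_transpose S"] cadjoint_flip_transpose[OF assms]
  by (simp add: fun_eq_iff)

lemma unitary_flip_transpose:
  assumes "unitary S"
  shows "unitary (flip_transpose S)"
proof -
  have S: "bounded_clinear S" using assms by (rule unitary_bounded_clinear)
  note cadjoint_flip_transpose[OF S]
  moreover have "bounded_clinear (flip_transpose S)"
    unfolding flip_transpose_def by (intro bounded_clinear_flip_conj bounded_clinear_cadjoint S)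
  ultimately show ?thesis
    using assms by (simp add: unitary_def flip_transpose_def fun_eq_iff)
qed

lemma von_neumann_algebra_commutant_rtrans: "von_neumann_algebra (commutant (range rtrans))"
  by (rule von_neumann_algebra_commutant) (auto simp: bounded_clinear_rtrans cadjoint_rtrans)

lemma cadjoint_in_von_neumann_algebra: "von_neumann_algebra M \<Longrightarrow> T \<in> M \<Longrightarrow> cadjoint T \<in> M"
  by (simp add: von_neumann_algebra_def)

lemma flip_transpose_in_commutant_rtrans:
  assumes "S \<in> commutant (range ltrans)"
  shows "flip_transpose S \<in> commutant (range rtrans)"
proof -
  have "cadjoint S \<in> commutant (range ltrans)"
    by (rule cadjoint_in_von_neumann_algebra[OF von_neumann_algebra_commutant_ltrans assms])
  from commutant_rangeD[OF this] commutant_bounded_clinear[OF this] show ?thesis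
    unfolding flip_transpose_def
    by (auto simp: commutant_def bounded_clinear_flip_conj flip_rtrans flip_ltrans fun_eq_iff
        simp del: comp_apply) (simp add: flip_rtrans flip_ltrans)
qed

lemma flip_transpose_in_commutant_ltrans:
  assumes "S \<in> commutant (range rtrans)"
  shows "flip_transpose S \<in> commutant (range ltrans)"
proof -
  have "cadjoint S \<in> commutant (range rtrans)"
    by (rule cadjoint_in_von_neumann_algebra[OF von_neumann_algebra_commutant_rtrans assms])
  from commutant_rangeD[OF this] commutant_bounded_clinear[OF this] show ?thesis
    unfolding flip_transpose_def
    by (auto simp: commutant_def bounded_clinear_flip_conj flip_rtrans flip_ltrans fun_eq_iff
        simp del: comp_apply) (simp add: flip_rtrans flip_ltrans)
qed

text \<open>An operator that commutes with left translations and its transpose have the same matrix row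
  at the identity of the group.\<close>

lemma coord_flip_transpose_zero:
  assumes S: "S \<in> commutant (range ltrans)"
  shows "coord (flip_transpose S f) 0 = coord (S f) 0"
proof -
  note bS = commutant_bounded_clinear[OF S]
  have "ltrans r (chi 0) = chi r" for r :: 'a
    using ltrans_chi_tensor[of r 0 "1::complex"] by (simp add: chi_tensor_one)
  then have "S (chi r) = ltrans r (S (chi 0))" for r
    using commutant_rangeD[OF S, of r "chi 0"] by simp
  then have adj: "cadjoint S (chi 0) = flip (S (chi 0))"
    by (intro ell2_eqI)
      (metis bS cadjoint_right cinner_chi cinner_commute flip.rep_eq ltrans.rep_eq add.right_neutral
        cadjoint_left)
  have "flip (chi 0) = (chi 0 :: ('a, complex) ell2)"
    by transfer (simp add: fun_eq_iff)
  then have "coord (flip_transpose S f) 0 = cinner (chi 0) (cadjoint S (flip f))"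
    unfolding flip_transpose_def by (simp add: cinner_chi[symmetric] cinner_flip)
  also have "\<dots> = cinner (flip (flip (S (chi 0)))) (flip f)"
    by (simp add: cadjoint_right[symmetric] bS)
  also have "\<dots> = cinner f (cadjoint S (chi 0))"
    unfolding adj by (subst cinner_flip) simp
  also have "\<dots> = coord (S f) 0"
    by (simp add: cadjoint_right[symmetric] bS cinner_chi)
  finally show ?thesis .
qed

section \<open>Unitaries with prescribed values\<close>

lemma subspace_closure:
  fixes S :: "'a::real_normed_vector set"
  assumes "subspace S"
  shows "subspace (closure S)"
proof (rule subspaceI)
  show "0 \<in> closure S" using closure_subset subspace_0[OF assms] by blast
next
  fix x y assume "x \<in> closure S" "y \<in> closure S"
  then obtain f g where "\<And>n. f n \<in> S" "f \<longlonglongrightarrow> x" "\<And>n. g n \<in> S" "g \<longlonglongrightarrow> y"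
    unfolding closure_sequential by blast
  then show "x + y \<in> closure S"
    unfolding closure_sequential
    by (intro exI[of _ "\<lambda>n. f n + g n"]) (simp add: subspace_add[OF assms] tendsto_add)
next
  fix c x assume "x \<in> closure S"
  then obtain f where "\<And>n. f n \<in> S" "f \<longlonglongrightarrow> x"
    unfolding closure_sequential by blast
  then show "c *\<^sub>R x \<in> closure S"
    unfolding closure_sequential
    by (intro exI[of _ "\<lambda>n. c *\<^sub>R f n"]) (simp add: subspace_scale[OF assms] tendsto_scaleR)
qed

lemma cinner_closure_span_eq_zero:
  fixes w :: "'a::complex_hilbert_space"
  assumes "\<And>s. s \<in> S \<Longrightarrow> cinner w s = 0" "x \<in> closure (span S)"
  shows "cinner w x = 0"
proof -
  have "subspace {x. cinner w x = 0}"
    by (auto simp: subspace_def cinner_add_right cinner_scaleR_right)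
  then have "span S \<subseteq> {x. cinner w x = 0}"
    using assms(1) by (intro span_minimal) auto
  moreover have "closed {x. cinner w x = 0}"
    by (intro closed_Collect_eq continuous_on_const
        linear_continuous_on bounded_linear_cinner_right)
  ultimately show ?thesis using assms(2) closure_minimal by blast
qed

text \<open>The vector \<open>z\<close> below is the image of \<open>x\<close> under the unitary that maps \<open>u i\<close> to \<open>v i\<close> for every
  \<open>i\<close> and fixes the orthogonal complement of these vectors.\<close>

lemma gram_transfer_exists:
  fixes u v :: "'i \<Rightarrow> 'a::complex_hilbert_space"
  assumes gram: "\<And>i j. cinner (u i) (u j) = cinner (v i) (v j)"
    and ranges: "range u = range v"
    and scale: "\<And>c i. c *\<^sub>C u i \<in> range u"
  shows "\<exists>z. norm z = norm x \<and> (\<forall>j. cinner z (v j) = cinner x (u j)) \<and>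
    (\<forall>w. (\<forall>j. cinner w (u j) = 0) \<longrightarrow> cinner z w = cinner x w)"
proof -
  define K where "K = closure (span (range u))"
  \<comment> \<open>\<open>D\<close> is the graph, on linear combinations, of the correspondence \<open>u i \<mapsto> v i\<close>; equality of the Gram
    matrices makes it isometric, so that it extends to the closure \<open>K\<close> of its domain.\<close>
  define D where "D = span (range (\<lambda>i. (u i, v i)))"
  have "subspace D" by (simp add: D_def)
  have fst_D: "fst ` D = span (range u)"
    unfolding D_def linear_span_image[OF linear_fst, symmetric] by (simp add: image_image)
  have snd_D: "snd ` D = span (range u)"
    unfolding D_def linear_span_image[OF linear_snd, symmetric] by (simp add: image_image ranges)
  have D1: "cinner (fst d) (u j) = cinner (snd d) (v j)" if "d \<in> D" for d j
    using that unfolding D_def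
    by (induction rule: span_induct)
      (auto simp: gram subspace_def cinner_add_left cinner_scaleR_left)
  have D2: "cinner (fst d) (fst d') = cinner (snd d) (snd d')" if "d \<in> D" "d' \<in> D" for d d'
    using that(2) unfolding D_def
    by (induction rule: span_induct)
      (auto simp: D1[OF that(1)] subspace_def cinner_add_right cinner_scaleR_right)
  have D_norm: "norm (fst d) = norm (snd d)" if "d \<in> D" for d
    using D2[OF that that] unfolding cinner_self_norm of_real_eq_iff
    by (simp add: power2_eq_iff_nonneg)
  have "subspace K" unfolding K_def by (intro subspace_closure subspace_span)
  moreover have "c *\<^sub>C k \<in> K" if "k \<in> K" for c k
  proof -
    have "(*\<^sub>C) c ` closure (span (range u)) \<subseteq> closure ((*\<^sub>C) c ` span (range u))"
      by (rule closure_bounded_linear_image_subset[OF bounded_linear_scaleC])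
    also have "(*\<^sub>C) c ` span (range u) = span ((*\<^sub>C) c ` range u)"
      by (rule linear_span_image[symmetric, OF bounded_linear.linear[OF bounded_linear_scaleC]])
    also have "closure \<dots> \<subseteq> K"
      unfolding K_def using scale by (intro closure_mono span_mono) auto
    finally show ?thesis using that K_def by blast
  qed
  moreover have "closed K" by (simp add: K_def)
  ultimately obtain p where p: "p \<in> K" "\<And>k. k \<in> K \<Longrightarrow> cinner (x - p) k = 0"
    using closest_point_orthogonal[of K x] by blast
  have uK: "u j \<in> K" for j
    using closure_subset[of "span (range u)"] span_base[of "u j" "range u"] by (auto simp: K_def)
  have vK: "v j \<in> K" for j using uK ranges by (metis rangeE rangeI)
  obtain f where f: "\<And>n. f n \<in> fst ` D" "f \<longlonglongrightarrow> p"
    using p(1) unfolding K_def fst_D[symmetric] closure_sequential by blast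
  then have "\<exists>d. \<forall>n. d n \<in> D \<and> fst (d n) = f n" by (intro choice) fastforce
  then obtain d where d: "\<And>n. d n \<in> D" "\<And>n. fst (d n) = f n" by blast
  have "norm (snd (d m) - snd (d n)) = norm (f m - f n)" for m n
    using D_norm[OF subspace_diff[OF \<open>subspace D\<close> d(1) d(1)], of m n] by (simp add: d(2))
  then have "Cauchy (\<lambda>n. snd (d n))"
    using LIMSEQ_imp_Cauchy[OF f(2)] by (simp add: Cauchy_iff)
  then obtain y where y: "(\<lambda>n. snd (d n)) \<longlonglongrightarrow> y"
    using Cauchy_convergent convergent_def by blast
  have "snd (d n) \<in> span (range u)" for n using d(1) snd_D by blast
  then have "y \<in> K" unfolding K_def closure_sequential
    using y by (intro exI[of _ "\<lambda>n. snd (d n)"]) blast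
  have "cinner y (v j) = cinner p (u j)" for j
  proof (rule LIMSEQ_unique)
    show "(\<lambda>n. cinner (snd (d n)) (v j)) \<longlonglongrightarrow> cinner y (v j)"
      by (rule tendsto_cinner_left[OF y])
    show "(\<lambda>n. cinner (snd (d n)) (v j)) \<longlonglongrightarrow> cinner p (u j)"
      using tendsto_cinner_left[OF f(2), of "u j"] by (simp add: D1[OF d(1), symmetric] d(2))
  qed
  moreover have "norm y = norm p"
  proof (rule LIMSEQ_unique)
    show "(\<lambda>n. norm (snd (d n))) \<longlonglongrightarrow> norm y" by (intro tendsto_norm y)
    show "(\<lambda>n. norm (snd (d n))) \<longlonglongrightarrow> norm p"
      using tendsto_norm[OF f(2)] by (simp add: D_norm[OF d(1), symmetric] d(2))
  qed
  ultimately show ?thesis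
  proof (intro exI[of _ "(x - p) + y"] conjI allI impI)
    assume ny: "norm y = norm p"
    have "(norm ((x - p) + y))\<^sup>2 = (norm ((x - p) + p))\<^sup>2"
      unfolding norm_sq_add by (simp add: ny p \<open>y \<in> K\<close>)
    then show "norm ((x - p) + y) = norm x" by (simp add: power2_eq_iff_nonneg)
  next
    fix j assume "\<And>j. cinner y (v j) = cinner p (u j)"
    then show "cinner ((x - p) + y) (v j) = cinner x (u j)"
      using p(2)[OF vK, of j] p(2)[OF uK, of j] by (simp add: cinner_add_left cinner_diff_left)
  next
    fix w assume "\<forall>j. cinner w (u j) = 0"
    then have "cinner w k = 0" if "k \<in> K" for k
      using cinner_closure_span_eq_zero[of "range u" w k] that by (auto simp: K_def)
    then have "cinner k w = 0" if "k \<in> K" for k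
      using that cinner_commute by (metis complex_cnj_zero)
    then show "cinner ((x - p) + y) w = cinner x w"
      using p(1) \<open>y \<in> K\<close> by (simp add: cinner_add_left cinner_diff_left)
  qed
qed

text \<open>Families with the same Gram matrix are unitarily equivalent.  The condition on the ranges allows
  the unitary to be the identity on the orthogonal complement, so that it commutes with every operator
  that, together with its adjoint, acts on both families through the same maps of the index set.  Closure
  of the families under complex scalars ensures that their real span is a complex subspace.\<close>

theorem gram_unitary_exists:
  fixes u v :: "'i \<Rightarrow> 'a::complex_hilbert_space"
  assumes gram: "\<And>i j. cinner (u i) (u j) = cinner (v i) (v j)"
    and ranges: "range u = range v"
    and scale: "\<And>c i. c *\<^sub>C u i \<in> range u"
  obtains V where "unitary V" "\<And>i. V (u i) = v i"
    "\<And>R \<alpha> \<beta> x. bounded_clinear R \<Longrightarrow> (\<And>i. R (u i) = u (\<alpha> i)) \<Longrightarrow> (\<And>i. R (v i) = v (\<alpha> i)) \<Longrightarrow>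
      (\<And>i. cadjoint R (u i) = u (\<beta> i)) \<Longrightarrow> (\<And>i. cadjoint R (v i) = v (\<beta> i)) \<Longrightarrow> V (R x) = R (V x)"
proof -
  \<comment> \<open>\<open>\<Phi> x z\<close> says that \<open>z\<close> is the image of \<open>x\<close>.  As \<open>z\<close> is determined by \<open>x\<close>, all algebraic
    properties of the unitary reduce to checking this relation.\<close>
  define \<Phi> where "\<Phi> x z \<longleftrightarrow> (\<forall>j. cinner z (v j) = cinner x (u j)) \<and>
    (\<forall>w. (\<forall>j. cinner w (u j) = 0) \<longrightarrow> cinner z w = cinner x w)" for x z
  have unique: "z = z'" if "\<Phi> x z" "\<Phi> x z'" for x z z'
  proof -
    have "cinner (z - z') (v j) = 0" for j
      using that by (simp add: \<Phi>_def cinner_diff_left)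
    then have "cinner (z - z') (u j) = 0" for j using ranges by (metis rangeE rangeI)
    then have "cinner (z - z') (z - z') = 0"
      using that unfolding \<Phi>_def cinner_diff_left[of z z' "z - z'"] by simp
    then show ?thesis by simp
  qed
  have "\<exists>z. norm z = norm x \<and> \<Phi> x z" for x
    unfolding \<Phi>_def by (rule gram_transfer_exists[OF gram ranges scale])
  then obtain V where norm_V: "\<And>x. norm (V x) = norm x" and \<Phi>_V: "\<And>x. \<Phi> x (V x)" by metis
  have VI: "V x = z" if "\<Phi> x z" for x z using unique \<Phi>_V that by blast
  have V: "bounded_clinear V"
  proof (rule bounded_clinearI[of _ 1])
    show "V (x + y) = V x + V y" for x y
      using \<Phi>_V[of x] \<Phi>_V[of y] by (intro VI) (simp add: \<Phi>_def cinner_add_left)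
    show "V (c *\<^sub>C x) = c *\<^sub>C V x" for c x
      using \<Phi>_V[of x] by (intro VI) (simp add: \<Phi>_def cinner_scaleC_left)
  qed (simp add: norm_V)
  have "surj V"
  proof (rule surjI)
    \<comment> \<open>Exchanging the families \<open>u\<close> and \<open>v\<close> turns \<open>\<Phi>\<close> into the converse relation.\<close>
    have "c *\<^sub>C v i \<in> range v" for c i
      using scale ranges by (metis rangeE rangeI)
    then have "\<exists>x. norm x = norm z \<and> (\<forall>j. cinner x (u j) = cinner z (v j)) \<and>
        (\<forall>w. (\<forall>j. cinner w (v j) = 0) \<longrightarrow> cinner x w = cinner z w)" for z
      using gram ranges by (intro gram_transfer_exists) auto
    moreover have "(\<forall>j. cinner w (v j) = 0) \<longleftrightarrow> (\<forall>j. cinner w (u j) = 0)" for w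
      using ranges by (metis rangeE rangeI)
    ultimately have "\<exists>x. \<Phi> x z" for z unfolding \<Phi>_def by metis
    then show "V (SOME x. \<Phi> x z) = z" for z by (metis VI someI_ex)
  qed
  then have "unitary V"
    by (rule unitary_surj_isometryI[OF V isometry_cinner[OF V norm_V]])
  moreover have "V (u i) = v i" for i
  proof (rule VI)
    have "cinner (v i) w = 0" "cinner (u i) w = 0" if "\<forall>j. cinner w (u j) = 0" for w
      using that ranges by (metis cinner_commute complex_cnj_zero rangeE rangeI)+
    then show "\<Phi> (u i) (v i)" by (simp add: \<Phi>_def gram)
  qed
  moreover have "V (R x) = R (V x)"
    if R: "bounded_clinear R" and "\<And>i. R (u i) = u (\<alpha> i)" "\<And>i. R (v i) = v (\<alpha> i)"
      and "\<And>i. cadjoint R (u i) = u (\<beta> i)" "\<And>i. cadjoint R (v i) = v (\<beta> i)" for R \<alpha> \<beta> x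
  proof (rule VI)
    show "\<Phi> (R x) (R (V x))"
      using \<Phi>_V[of x] that by (simp add: \<Phi>_def cadjoint_right cadjoint_left)
  qed
  ultimately show ?thesis by (rule that)
qed

section \<open>Parseval frame generators\<close>

lemma
  assumes "unitary_rep \<pi>"
  shows unitary_rep_bounded_clinear: "bounded_clinear (\<pi> g)"
    and unitary_rep_add: "\<pi> (g + h) x = \<pi> g (\<pi> h x)"
    and unitary_rep_zero: "\<pi> 0 x = x"
    and unitary_rep_cinner: "cinner (\<pi> g x) y = cinner x (\<pi> (- g) y)"
proof -
  show b: "bounded_clinear (\<pi> g)" for g
    using assms by (simp add: unitary_rep_def unitary_bounded_clinear)
  show add: "\<pi> (g + h) x = \<pi> g (\<pi> h x)" for g h x
    using assms by (simp add: unitary_rep_def)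
  have u: "unitary (\<pi> g)" for g using assms by (simp add: unitary_rep_def)
  show zero: "\<pi> 0 x = x" for x
    using add[of 0 0 x] unitary_cadjoint_cancel(1)[OF u, of 0 "\<pi> 0 x"]
      unitary_cadjoint_cancel(1)[OF u, of 0 x] by simp
  have "\<pi> g (\<pi> (- g) y) = y"
    using add[of g "- g" y] zero by simp
  then show "cinner (\<pi> g x) y = cinner x (\<pi> (- g) y)"
    using unitary_cinner[OF u, of g x "\<pi> (- g) y"] by simp
qed

text \<open>The adjoint of a bounded operator that intertwines \<open>\<pi>\<close> with left translations intertwines in
  the opposite direction.\<close>

lemma cadjoint_intertwines:
  assumes rep: "unitary_rep \<pi>" and Q: "bounded_clinear Q" "\<And>h x. Q (\<pi> h x) = ltrans h (Q x)"
  shows "cadjoint Q (ltrans h f) = \<pi> h (cadjoint Q f)"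
proof (rule cinner_extI)
  fix y
  show "cinner (cadjoint Q (ltrans h f)) y = cinner (\<pi> h (cadjoint Q f)) y"
    by (simp add: cadjoint_left Q cinner_ltrans unitary_rep_cinner[OF rep])
qed

lemma cadjoint_L_op: "cadjoint (L_op g) = (\<lambda>f. coord f g)"
proof (rule cadjoint_eqI[OF bounded_clinear_coord])
  show "cinner (L_op g h) f = cinner h (coord f g)" for h f
    using cinner_chi_tensor[of f g h] unfolding L_op_def by (metis cinner_commute)
qed

context
  fixes \<pi> :: "'g::group_add \<Rightarrow> 'h::complex_hilbert_space \<Rightarrow> 'h"
    and A :: "'h \<Rightarrow> 'o::complex_hilbert_space"
  assumes rep: "unitary_rep \<pi>" and A: "parseval_frame_generator \<pi> A"
begin

lemma generator_bounded_clinear: "bounded_clinear A"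
  using A by (simp add: parseval_frame_generator_def)

lemma has_sum_norm_sq_frame_coefficients:
  "((\<lambda>g. (norm (A (\<pi> (- g) x)))\<^sup>2) has_sum (norm x)\<^sup>2) UNIV"
proof -
  have "((\<lambda>g. cinner (\<pi> g (cadjoint A (A (\<pi> (- g) x)))) x) has_sum cinner x x) UNIV"
    using A unfolding parseval_frame_generator_def
    by (intro has_sum_bounded_linear[OF bounded_linear_cinner_left]) blast
  moreover have "cinner (\<pi> g (cadjoint A (A (\<pi> (- g) x)))) x
      = complex_of_real ((norm (A (\<pi> (- g) x)))\<^sup>2)" for g
    unfolding cinner_self_norm[symmetric]
    by (simp add: unitary_rep_cinner[OF rep] cadjoint_left generator_bounded_clinear)
  ultimately have "((\<lambda>g. complex_of_real ((norm (A (\<pi> (- g) x)))\<^sup>2)) has_sum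
      complex_of_real ((norm x)\<^sup>2)) UNIV"
    by (simp only: cinner_self_norm)
  from has_sum_bounded_linear[OF bounded_linear_Re this] show ?thesis by simp
qed

lemma coord_analysis_op: "coord (analysis_op \<pi> A x) g = A (\<pi> (- g) x)"
proof -
  define f where "f = Abs_ell2 (\<lambda>g. A (\<pi> (- g) x))"
  have f: "coord f = (\<lambda>g. A (\<pi> (- g) x))"
    using has_sum_imp_summable[OF has_sum_norm_sq_frame_coefficients[of x]]
    by (simp add: f_def Abs_ell2_inverse)
  have "analysis_op \<pi> A x = f"
    using infsumI[OF has_sum_chi_tensor[of f]] by (simp add: f analysis_op_def L_op_def)
  then show ?thesis by (simp add: f)
qed

lemma norm_analysis_op: "norm (analysis_op \<pi> A x) = norm x"
  using infsumI[OF has_sum_norm_sq_frame_coefficients[of x]]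
  by (simp add: norm_ell2.rep_eq coord_analysis_op)

lemma bounded_clinear_analysis_op: "bounded_clinear (analysis_op \<pi> A)"
  by (rule bounded_clinearI[of _ 1])
    (auto intro!: ell2_eqI simp: norm_analysis_op coord_analysis_op plus_ell2.rep_eq
      scaleC_ell2.rep_eq bounded_clinear_simps[OF generator_bounded_clinear]
      bounded_clinear_simps[OF unitary_rep_bounded_clinear[OF rep]])

lemma cadjoint_analysis_op_cancel: "cadjoint (analysis_op \<pi> A) (analysis_op \<pi> A x) = x"
  by (rule cinner_extI) (simp add: cadjoint_left bounded_clinear_analysis_op
      isometry_cinner[OF bounded_clinear_analysis_op norm_analysis_op])

lemma analysis_op_intertwines: "analysis_op \<pi> A (\<pi> h x) = ltrans h (analysis_op \<pi> A x)"
  by (rule ell2_eqI)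
    (simp add: coord_analysis_op ltrans.rep_eq minus_add unitary_rep_add[OF rep])

lemma cadjoint_analysis_op_intertwines:
  "cadjoint (analysis_op \<pi> A) (ltrans h f) = \<pi> h (cadjoint (analysis_op \<pi> A) f)"
  by (rule cadjoint_intertwines[OF rep bounded_clinear_analysis_op analysis_op_intertwines])

lemma coord_analysis_op_zero: "coord (analysis_op \<pi> A x) 0 = A x"
  by (simp add: coord_analysis_op unitary_rep_zero[OF rep])

lemma bounded_clinear_frame_projection: "bounded_clinear (frame_projection \<pi> A)"
  unfolding frame_projection_def
  by (intro bounded_clinear_compose bounded_clinear_analysis_op bounded_clinear_cadjoint)

lemma frame_projection_ltrans:
  "frame_projection \<pi> A (ltrans g f) = ltrans g (frame_projection \<pi> A f)"
  by (simp add: frame_projection_def cadjoint_analysis_op_intertwines analysis_op_intertwines)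

end

context
  fixes \<pi> :: "'g::group_add \<Rightarrow> 'h::complex_hilbert_space \<Rightarrow> 'h"
    and A B :: "'h \<Rightarrow> 'o::complex_hilbert_space"
  assumes rep: "unitary_rep \<pi>"
    and A: "parseval_frame_generator \<pi> A" and B: "parseval_frame_generator \<pi> B"
begin

text \<open>An operator that commutes with left translations is determined on the range of the analysis
  operator by its coordinate at the identity.\<close>

lemma analysis_op_eq_compose:
  assumes X: "X \<in> commutant (range ltrans)" and "\<And>x. B x = coord (X (analysis_op \<pi> A x)) 0"
  shows "analysis_op \<pi> B = X \<circ> analysis_op \<pi> A"
proof
  fix x
  have "coord (X (analysis_op \<pi> A (\<pi> (- g) x))) 0 = coord (X (analysis_op \<pi> A x)) g" for g
    by (simp add: analysis_op_intertwines[OF rep A] commutant_rangeD[OF X] ltrans.rep_eq)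
  then show "analysis_op \<pi> B x = (X \<circ> analysis_op \<pi> A) x"
    by (intro ell2_eqI) (simp add: coord_analysis_op[OF rep B] assms(2))
qed

lemma frame_projection_conj:
  assumes "bounded_clinear X" "analysis_op \<pi> B = X \<circ> analysis_op \<pi> A"
  shows "frame_projection \<pi> B = X \<circ> frame_projection \<pi> A \<circ> cadjoint X"
  using assms by (simp add: frame_projection_def cadjoint_compose
      bounded_clinear_analysis_op[OF rep A] o_assoc)

subsection \<open>Equality of frame projections\<close>

lemma same_projection_of_unitary_tensor:
  assumes W: "W \<in> commutant (range ltrans)" "unitary W"
    and comm: "W \<circ> frame_projection \<pi> A = frame_projection \<pi> A \<circ> W"
    and B_eq: "B = cadjoint (L_op 0) \<circ> W \<circ> analysis_op \<pi> A"
  shows "frame_projection \<pi> B = frame_projection \<pi> A"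
proof -
  have "analysis_op \<pi> B = W \<circ> analysis_op \<pi> A"
    using W(1) by (rule analysis_op_eq_compose) (simp add: B_eq cadjoint_L_op)
  then have "frame_projection \<pi> B = W \<circ> frame_projection \<pi> A \<circ> cadjoint W"
    by (rule frame_projection_conj[OF unitary_bounded_clinear[OF W(2)]])
  also have "\<dots> = frame_projection \<pi> A"
    unfolding comm using W(2) by (simp add: fun_eq_iff unitary_cadjoint_cancel)
  finally show ?thesis .
qed

lemma unitary_commutant_of_same_projection:
  assumes eq: "frame_projection \<pi> B = frame_projection \<pi> A"
  shows "\<exists>U\<in>commutant (range \<pi>). unitary U \<and> B = A \<circ> U"
proof -
  define \<theta> \<theta>' where "\<theta> = analysis_op \<pi> A" and "\<theta>' = analysis_op \<pi> B"
  have b: "bounded_clinear \<theta>" "bounded_clinear \<theta>'"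
    by (simp_all add: \<theta>_def \<theta>'_def bounded_clinear_analysis_op[OF rep] A B)
  have cancel: "cadjoint \<theta> (\<theta> x) = x" "cadjoint \<theta>' (\<theta>' x) = x" for x
    by (simp_all add: \<theta>_def \<theta>'_def cadjoint_analysis_op_cancel[OF rep] A B)
  have proj: "\<theta>' (cadjoint \<theta>' f) = \<theta> (cadjoint \<theta> f)" for f
    using fun_cong[OF eq, of f] by (simp add: \<theta>_def \<theta>'_def frame_projection_def)
  have proj': "\<theta> (cadjoint \<theta> (\<theta>' x)) = \<theta>' x" for x
    unfolding proj[symmetric] by (simp add: cancel)
  define U where "U = cadjoint \<theta> \<circ> \<theta>'"
  have U: "bounded_clinear U"
    by (simp add: U_def b bounded_clinear_compose bounded_clinear_cadjoint)
  have "unitary U"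
  proof (rule unitaryI(1)[OF U, of "cadjoint \<theta>' \<circ> \<theta>"])
    show "bounded_clinear (cadjoint \<theta>' \<circ> \<theta>)"
      by (simp add: b bounded_clinear_compose bounded_clinear_cadjoint)
    show "cinner (U x) y = cinner x ((cadjoint \<theta>' \<circ> \<theta>) y)" for x y
      by (simp add: U_def b cadjoint_left cadjoint_right)
    show "U ((cadjoint \<theta>' \<circ> \<theta>) x) = x" for x by (simp add: U_def proj cancel)
    show "(cadjoint \<theta>' \<circ> \<theta>) (U x) = x" for x by (simp add: U_def proj' cancel)
  qed
  moreover have "U \<in> commutant (range \<pi>)"
    using U by (auto simp: commutant_def fun_eq_iff U_def \<theta>_def \<theta>'_def
        analysis_op_intertwines[OF rep] cadjoint_analysis_op_intertwines[OF rep] A B)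
  moreover have "B x = A (U x)" for x
    using coord_analysis_op_zero[OF rep A, of "U x"] coord_analysis_op_zero[OF rep B, of x] proj'[of x]
    by (simp add: U_def \<theta>_def \<theta>'_def)
  ultimately show ?thesis by (intro bexI[of _ U]) (auto simp: fun_eq_iff)
qed

text \<open>A unitary \<open>U\<close> in the commutant of the representation is transported to the range of the frame
  projection and extended by the identity on its orthogonal complement.\<close>

lemma unitary_tensor_of_unitary_commutant:
  assumes U: "U \<in> commutant (range \<pi>)" "unitary U" and B_eq: "B = A \<circ> U"
  shows "\<exists>W\<in>commutant (range ltrans). unitary W \<and>
    W \<circ> frame_projection \<pi> A = frame_projection \<pi> A \<circ> W \<and>
    B = cadjoint (L_op 0) \<circ> W \<circ> analysis_op \<pi> A"
proof -
  define \<theta> where "\<theta> = analysis_op \<pi> A"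
  define P where "P = frame_projection \<pi> A"
  have b: "bounded_clinear \<theta>" "bounded_clinear (cadjoint \<theta>)" "bounded_clinear P"
    by (simp_all add: \<theta>_def P_def bounded_clinear_analysis_op[OF rep A]
        bounded_clinear_frame_projection[OF rep A] bounded_clinear_cadjoint)
  have cancel: "cadjoint \<theta> (\<theta> x) = x" for x
    by (simp add: \<theta>_def cadjoint_analysis_op_cancel[OF rep A])
  have P: "P f = \<theta> (cadjoint \<theta> f)" for f by (simp add: P_def \<theta>_def frame_projection_def)
  have lin: "\<theta> (x + y) = \<theta> x + \<theta> y" "\<theta> (x - y) = \<theta> x - \<theta> y"
    "cadjoint \<theta> (f + f') = cadjoint \<theta> f + cadjoint \<theta> f'"
    "cadjoint \<theta> (f - f') = cadjoint \<theta> f - cadjoint \<theta> f'" for x y f f'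
    by (simp_all add: bounded_clinear_simps[OF b(1)] bounded_clinear_simps[OF b(2)])
  define E where "E U f = \<theta> (U (cadjoint \<theta> f)) + (f - P f)" for U f
  have E_bounded: "bounded_clinear (E U)" if "bounded_clinear U" for U
    unfolding E_def[abs_def]
    using bounded_clinear_plus[OF bounded_clinear_compose[OF b(1) bounded_clinear_compose[OF that b(2)]]
        bounded_clinear_minus[OF bounded_clinear_id b(3)]] by simp
  have E_adj: "cinner (E U f) f' = cinner f (E (cadjoint U) f')" if "bounded_clinear U" for U f f'
    by (simp add: E_def P cinner_add_left cinner_add_right cinner_diff_left cinner_diff_right
        cadjoint_right[OF b(1)] cadjoint_right[OF that] cadjoint_left[OF b(1)])
  have E_E: "E U (E U' f) = E (U \<circ> U') f" for U U' f
    by (simp add: E_def P lin cancel)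
  have E_id: "E id f = f" for f by (simp add: E_def P)
  have bU: "bounded_clinear U" using U(2) by (rule unitary_bounded_clinear)
  have "unitary (E U)"
  proof (rule unitaryI(1)[OF E_bounded[OF bU] E_bounded[OF bounded_clinear_cadjoint[OF bU]]
        E_adj[OF bU]])
    show "E U (E (cadjoint U) f) = f" "E (cadjoint U) (E U f) = f" for f
      using U(2) by (simp_all add: E_E unitary_def E_id)
  qed
  moreover have "E U \<in> commutant (range ltrans)"
  proof -
    have "E U (ltrans h f) = ltrans h (E U f)" for h f
      by (simp add: E_def P \<theta>_def analysis_op_intertwines[OF rep A]
          cadjoint_analysis_op_intertwines[OF rep A] commutant_rangeD[OF U(1)]
          bounded_clinear_simps[OF bounded_clinear_ltrans])
    then show ?thesis by (simp add: commutant_def E_bounded bU fun_eq_iff)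
  qed
  moreover have "E U \<circ> P = P \<circ> E U"
    by (simp add: fun_eq_iff E_def P lin cancel)
  moreover have "E U (\<theta> x) = \<theta> (U x)" for x by (simp add: E_def P cancel)
  then have "B = cadjoint (L_op 0) \<circ> E U \<circ> \<theta>"
    by (simp add: fun_eq_iff B_eq cadjoint_L_op \<theta>_def coord_analysis_op_zero[OF rep A])
  ultimately show ?thesis unfolding P_def \<theta>_def by blast
qed

subsection \<open>Unitaries in the bicommutant of the representation\<close>

lemma coord_op_tensor_flip_transpose_zero:
  fixes f :: "('g, 'o) ell2"
  assumes W: "W \<in> commutant (range ltrans)" and V: "bounded_clinear (flip_transpose W)"
  shows "coord ((flip_transpose W \<otimes>\<^sub>o\<^sub>p id) f) 0 = coord ((W \<otimes>\<^sub>o\<^sub>p id) f) 0"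
proof (rule cinner_extI)
  fix k :: 'o
  let ?\<phi> = "\<lambda>h. cinner h k"
  note slice = bounded_clinear_cinner_left[of k]
  have "cinner (coord ((S \<otimes>\<^sub>o\<^sub>p id) f) 0) k = coord (S (amp ?\<phi> f)) 0" if "bounded_clinear S" for S
    unfolding amp_op_tensor_id_functional[OF that slice, symmetric] by (simp add: coord_amp[OF slice])
  then show "cinner (coord ((flip_transpose W \<otimes>\<^sub>o\<^sub>p id) f) 0) k = cinner (coord ((W \<otimes>\<^sub>o\<^sub>p id) f) 0) k"
    by (simp add: V commutant_bounded_clinear[OF W] coord_flip_transpose_zero[OF W])
qed

text \<open>The unitary on \<open>('g, complex) ell2\<close> that corresponds to a unitary \<open>U\<close> in the bicommutant is found
  from the scalar coefficients of the frame: the right translates of the slices of \<open>\<theta> x\<close> and of \<open>\<theta> (U x)\<close>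
  have the same Gram matrix, because its entries are matrix coefficients of operators in the commutant of
  the representation, with which \<open>U\<close> commutes.\<close>

lemma right_vN_unitary_of_bicommutant_unitary:
  assumes U: "U \<in> commutant (commutant (range \<pi>))" "unitary U" and B_eq: "B = A \<circ> U"
  shows "\<exists>W\<in>\<R>. unitary W \<and> B = cadjoint (L_op 0) \<circ> (W \<otimes>\<^sub>o\<^sub>p id) \<circ> analysis_op \<pi> A"
proof -
  define \<theta> where "\<theta> = analysis_op \<pi> A"
  define Q where "Q g k = rtrans g \<circ> amp (\<lambda>h. cinner h k) \<circ> \<theta>" for g k
  note slice = bounded_clinear_cinner_left
  have bQ: "bounded_clinear (Q g k)" for g k
    unfolding Q_def \<theta>_def
    by (intro bounded_clinear_compose bounded_clinear_rtrans bounded_clinear_amp slice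
        bounded_clinear_analysis_op[OF rep A])
  have bU: "bounded_clinear U" using U(2) by (rule unitary_bounded_clinear)
  have Q_\<pi>: "Q g k (\<pi> h x) = ltrans h (Q g k x)" for g k h x
    by (simp add: Q_def \<theta>_def analysis_op_intertwines[OF rep A] amp_ltrans[OF slice] ltrans_rtrans)
  have Q_adj_\<pi>: "cadjoint (Q g k) (ltrans h f) = \<pi> h (cadjoint (Q g k) f)" for g k h f
    by (rule cadjoint_intertwines[OF rep bQ Q_\<pi>])
  \<comment> \<open>\<open>Q g k x\<close> is the right translate by \<open>g\<close> of the family of coefficients \<open>cinner (A (\<pi> (- s) x)) k\<close>.\<close>
  define u where "u = (\<lambda>(g, k, x). Q g k x)"
  define v where "v = (\<lambda>(g, k, x). Q g k (U x))"
  have gram: "cinner (u i) (u j) = cinner (v i) (v j)" for i j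
  proof -
    obtain g k x g' k' x' where ij: "i = (g, k, x)" "j = (g', k', x')" by (metis prod_cases3)
    define X where "X = cadjoint (Q g' k') \<circ> Q g k"
    have "X \<in> commutant (range \<pi>)"
      by (auto simp: commutant_def X_def fun_eq_iff bQ bounded_clinear_compose bounded_clinear_cadjoint
          Q_\<pi> Q_adj_\<pi>)
    then have "U (X x) = X (U x)" using U(1) by (auto simp: commutant_def fun_eq_iff)
    then have "cinner (X x) x' = cinner (X (U x)) (U x')"
      by (metis unitary_cinner[OF U(2)])
    then show ?thesis by (simp add: ij u_def v_def X_def cadjoint_left[OF bQ])
  qed
  have "v (g, k, x) = u (g, k, U x)" "u (g, k, x) = v (g, k, cadjoint U x)" for g k x
    by (simp_all add: u_def v_def unitary_cadjoint_cancel[OF U(2)])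
  then have ranges: "range u = range v"
    by (intro antisym; clarify) (metis rangeI)+
  have scale: "c *\<^sub>C u i \<in> range u" for c i
  proof -
    obtain g k x where i: "i = (g, k, x)" by (metis prod_cases3)
    then have "c *\<^sub>C u i = u (g, k, c *\<^sub>C x)"
      by (simp add: u_def bounded_clinear_scaleC[OF bQ])
    then show ?thesis by simp
  qed
  obtain V where V: "unitary V" "\<And>i. V (u i) = v i"
    and V_comm: "\<And>R \<alpha> \<beta> f. bounded_clinear R \<Longrightarrow> (\<And>i. R (u i) = u (\<alpha> i)) \<Longrightarrow>
      (\<And>i. R (v i) = v (\<alpha> i)) \<Longrightarrow> (\<And>i. cadjoint R (u i) = u (\<beta> i)) \<Longrightarrow>
      (\<And>i. cadjoint R (v i) = v (\<beta> i)) \<Longrightarrow> V (R f) = R (V f)"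
    using gram_unitary_exists[OF gram ranges scale] by blast
  have bV: "bounded_clinear V" using V(1) by (rule unitary_bounded_clinear)
  have shift: "rtrans g (Q g' k x) = Q (g + g') k x" for g g' k x
    by (rule ell2_eqI) (simp add: Q_def rtrans.rep_eq add.assoc)
  have "V (rtrans g f) = rtrans g (V f)" for g f
    by (rule V_comm[of _ "\<lambda>(g', k, x). (g + g', k, x)" "\<lambda>(g', k, x). (- g + g', k, x)"])
      (auto simp: bounded_clinear_rtrans cadjoint_rtrans u_def v_def shift split: prod.splits)
  then have V_rtrans: "V \<in> commutant (range rtrans)"
    by (auto simp: commutant_def bV fun_eq_iff)
  define W where "W = flip_transpose V"
  have W: "W \<in> commutant (range ltrans)"
    unfolding W_def by (rule flip_transpose_in_commutant_ltrans[OF V_rtrans])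
  have W_V: "flip_transpose W = V"
    unfolding W_def by (rule flip_transpose_flip_transpose[OF bV])
  have "coord ((W \<otimes>\<^sub>o\<^sub>p id) (\<theta> x)) 0 = A (U x)" for x
  proof -
    have "coord ((W \<otimes>\<^sub>o\<^sub>p id) (\<theta> x)) 0 = coord ((V \<otimes>\<^sub>o\<^sub>p id) (\<theta> x)) 0"
      using coord_op_tensor_flip_transpose_zero[OF W] by (simp add: W_V bV)
    also have "\<dots> = A (U x)"
    proof (rule cinner_extI)
      fix k
      have rtrans_zero: "rtrans 0 f = f" for f :: "('g, complex) ell2"
        by (rule ell2_eqI) (simp add: rtrans.rep_eq)
      have "cinner (coord ((V \<otimes>\<^sub>o\<^sub>p id) (\<theta> x)) 0) k = coord (V (amp (\<lambda>h. cinner h k) (\<theta> x))) 0"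
        unfolding amp_op_tensor_id_functional[OF bV slice, symmetric]
        by (simp add: coord_amp[OF slice])
      also have "amp (\<lambda>h. cinner h k) (\<theta> x) = u (0, k, x)"
        by (simp add: u_def Q_def rtrans_zero)
      also have "coord (V \<dots>) 0 = cinner (A (U x)) k"
        by (simp add: V(2) v_def Q_def rtrans_zero coord_amp[OF slice] \<theta>_def
            coord_analysis_op_zero[OF rep A])
      finally show "cinner (coord ((V \<otimes>\<^sub>o\<^sub>p id) (\<theta> x)) 0) k = cinner (A (U x)) k" .
    qed
    finally show ?thesis .
  qed
  then have "B = cadjoint (L_op 0) \<circ> (W \<otimes>\<^sub>o\<^sub>p id) \<circ> \<theta>"
    by (simp add: fun_eq_iff B_eq cadjoint_L_op)
  moreover have "unitary W" unfolding W_def by (rule unitary_flip_transpose[OF V(1)])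
  ultimately show ?thesis using W by (auto simp: right_group_vN_eq_commutant \<theta>_def)
qed

text \<open>Conversely, the transpose \<open>V\<close> of \<open>W\<close> lies in the left group von Neumann algebra, so that its
  amplification commutes with the frame projection and compresses to a unitary in the bicommutant.\<close>

lemma bicommutant_unitary_of_right_vN_unitary:
  assumes W: "W \<in> \<R>" "unitary W"
    and B_eq: "B = cadjoint (L_op 0) \<circ> (W \<otimes>\<^sub>o\<^sub>p id) \<circ> analysis_op \<pi> A"
  shows "\<exists>U\<in>commutant (commutant (range \<pi>)). unitary U \<and> B = A \<circ> U"
proof -
  define \<theta> where "\<theta> = analysis_op \<pi> A"
  define P where "P = frame_projection \<pi> A"
  have W': "W \<in> commutant (range ltrans)" using W(1) by (simp add: right_group_vN_eq_commutant)
  have b: "bounded_clinear \<theta>" "bounded_clinear (cadjoint \<theta>)"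
    by (simp_all add: \<theta>_def bounded_clinear_analysis_op[OF rep A] bounded_clinear_cadjoint)
  have cancel: "cadjoint \<theta> (\<theta> x) = x" for x
    by (simp add: \<theta>_def cadjoint_analysis_op_cancel[OF rep A])
  have P: "P f = \<theta> (cadjoint \<theta> f)" for f by (simp add: P_def \<theta>_def frame_projection_def)
  define V0 where "V0 = flip_transpose W"
  have V0: "unitary V0" unfolding V0_def by (rule unitary_flip_transpose[OF W(2)])
  have bV0: "bounded_clinear V0" using V0 by (rule unitary_bounded_clinear)
  have V0_rtrans: "V0 (rtrans g f) = rtrans g (V0 f)" for g f
    unfolding V0_def by (rule commutant_rangeD[OF flip_transpose_in_commutant_rtrans[OF W']])
  define V where "V = V0 \<otimes>\<^sub>o\<^sub>p (id :: 'o \<Rightarrow> 'o)"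
  have V: "unitary V" unfolding V_def by (rule unitary_op_tensor_id[OF V0])
  have bV: "bounded_clinear V" using V by (rule unitary_bounded_clinear)
  have V_comm: "X (V f) = V (X f)" if "X \<in> commutant (range ltrans)" for X f
  proof -
    have "X \<circ> V = V \<circ> X"
      using that bV unfolding V_def
      by (intro translation_commutation)
        (auto simp: op_tensor_id_rtrans op_tensor_id_amp bV0 V0_rtrans
          dest: commutant_rangeD commutant_bounded_clinear)
    then show ?thesis by (simp add: fun_eq_iff)
  qed
  have "P \<in> commutant (range ltrans)"
    by (auto simp: commutant_def fun_eq_iff P_def bounded_clinear_frame_projection[OF rep A]
        frame_projection_ltrans[OF rep A])
  then have VP: "V (P f) = P (V f)" for f by (simp add: V_comm)
  have P\<theta>: "P (\<theta> x) = \<theta> x" for x by (simp add: P cancel)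
  define U where "U = cadjoint \<theta> \<circ> V \<circ> \<theta>"
  have \<theta>U: "\<theta> (U x) = V (\<theta> x)" for x
    by (simp add: U_def P[symmetric] VP[symmetric] P\<theta>)
  have U: "bounded_clinear U"
    unfolding U_def by (intro bounded_clinear_compose b bV)
  have "unitary U"
  proof (rule unitaryI(1)[OF U, of "cadjoint \<theta> \<circ> cadjoint V \<circ> \<theta>"])
    show "bounded_clinear (cadjoint \<theta> \<circ> cadjoint V \<circ> \<theta>)"
      by (intro bounded_clinear_compose b bounded_clinear_cadjoint bV)
    show "cinner (U x) y = cinner x ((cadjoint \<theta> \<circ> cadjoint V \<circ> \<theta>) y)" for x y
      by (simp add: U_def b cadjoint_left[OF b(1)] cadjoint_right[OF bV] cadjoint_right[OF b(1)])
    show "U ((cadjoint \<theta> \<circ> cadjoint V \<circ> \<theta>) x) = x" for x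
      by (simp add: U_def P[symmetric] VP unitary_cadjoint_cancel[OF V])
        (simp add: P cancel)
    show "(cadjoint \<theta> \<circ> cadjoint V \<circ> \<theta>) (U x) = x" for x
      by (simp add: \<theta>U unitary_cadjoint_cancel[OF V] cancel)
  qed
  moreover have "U \<in> commutant (commutant (range \<pi>))"
  proof -
    have "U (T x) = T (U x)" if T: "T \<in> commutant (range \<pi>)" for T x
    proof -
      have "\<theta> \<circ> T \<circ> cadjoint \<theta> \<in> commutant (range ltrans)"
        by (auto simp: commutant_def fun_eq_iff b \<theta>_def bounded_clinear_analysis_op[OF rep A]
            bounded_clinear_compose bounded_clinear_cadjoint commutant_bounded_clinear[OF T]
            analysis_op_intertwines[OF rep A] cadjoint_analysis_op_intertwines[OF rep A]
            commutant_rangeD[OF T])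
      from V_comm[OF this, of "\<theta> x", symmetric] show ?thesis by (simp add: U_def cancel)
    qed
    then show ?thesis by (auto simp: commutant_def[of "commutant (range \<pi>)"] U fun_eq_iff)
  qed
  moreover have "B x = A (U x)" for x
  proof -
    have "A (U x) = coord (\<theta> (U x)) 0" by (simp add: \<theta>_def coord_analysis_op_zero[OF rep A])
    also have "\<dots> = coord ((W \<otimes>\<^sub>o\<^sub>p id) (\<theta> x)) 0"
      using coord_op_tensor_flip_transpose_zero[OF W', of "\<theta> x"] bV0
      by (simp add: \<theta>U V_def V0_def)
    finally show ?thesis by (simp add: B_eq cadjoint_L_op \<theta>_def)
  qed
  ultimately show ?thesis by (intro bexI[of _ U]) (auto simp: fun_eq_iff)
qed

end

theorem proposition7p6:
  fixes \<pi> :: "'g::group_add \<Rightarrow> 'h::complex_hilbert_space \<Rightarrow> 'h"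
    and A B :: "'h \<Rightarrow> 'o::complex_hilbert_space"
  assumes "unitary_rep \<pi>"
    and "parseval_frame_generator \<pi> A"
    and "parseval_frame_generator \<pi> B"
  shows
    "(let unitary_commutant = (\<exists>U\<in>commutant (range \<pi>). unitary U \<and> B = A \<circ> U);
          unitary_tensor = (\<exists>W\<in>\<R> \<otimes>\<^sub>v\<^sub>N {T :: 'o \<Rightarrow> 'o. bounded_clinear T}. unitary W \<and>
            W \<circ> frame_projection \<pi> A = frame_projection \<pi> A \<circ> W \<and>
            B = cadjoint (L_op 0) \<circ> W \<circ> analysis_op \<pi> A);
          same_projection = (frame_projection \<pi> B = frame_projection \<pi> A)
      in (unitary_commutant \<longleftrightarrow> unitary_tensor) \<and> (unitary_tensor \<longleftrightarrow> same_projection))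
    \<and>
     (\<forall>U :: 'o \<Rightarrow> 'o. unitary U \<longrightarrow>
      (B = U \<circ> A \<longleftrightarrow> B = cadjoint (L_op 0) \<circ> (id \<otimes>\<^sub>o\<^sub>p U) \<circ> analysis_op \<pi> A) \<and>
      (B = U \<circ> A \<longrightarrow> frame_projection \<pi> B =
        (id \<otimes>\<^sub>o\<^sub>p U) \<circ> frame_projection \<pi> A \<circ> (id \<otimes>\<^sub>o\<^sub>p cadjoint U)))
    \<and>
     ((\<exists>U\<in>commutant (commutant (range \<pi>)). unitary U \<and> B = A \<circ> U) \<longleftrightarrow>
      (\<exists>W\<in>\<R>. unitary W \<and> B = cadjoint (L_op 0) \<circ> (W \<otimes>\<^sub>o\<^sub>p id) \<circ> analysis_op \<pi> A))
    \<and>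
     (\<forall>W\<in>\<R>. unitary W \<and> B = cadjoint (L_op 0) \<circ> (W \<otimes>\<^sub>o\<^sub>p id) \<circ> analysis_op \<pi> A \<longrightarrow>
        frame_projection \<pi> B =
          (W \<otimes>\<^sub>o\<^sub>p id) \<circ> frame_projection \<pi> A \<circ> (cadjoint W \<otimes>\<^sub>o\<^sub>p id))"
proof (intro conjI allI impI ballI)
  note unitary_tensor_of_unitary_commutant[OF assms] unitary_commutant_of_same_projection[OF assms]
    same_projection_of_unitary_tensor[OF assms]
  then show "let unitary_commutant = (\<exists>U\<in>commutant (range \<pi>). unitary U \<and> B = A \<circ> U);
          unitary_tensor = (\<exists>W\<in>\<R> \<otimes>\<^sub>v\<^sub>N {T :: 'o \<Rightarrow> 'o. bounded_clinear T}. unitary W \<and>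
            W \<circ> frame_projection \<pi> A = frame_projection \<pi> A \<circ> W \<and>
            B = cadjoint (L_op 0) \<circ> W \<circ> analysis_op \<pi> A);
          same_projection = (frame_projection \<pi> B = frame_projection \<pi> A)
      in (unitary_commutant \<longleftrightarrow> unitary_tensor) \<and> (unitary_tensor \<longleftrightarrow> same_projection)"
    unfolding vN_tensor_eq_commutant Let_def by blast
next
  fix U :: "'o \<Rightarrow> 'o"
  assume "unitary U"
  then have U: "bounded_clinear U" by (rule unitary_bounded_clinear)
  have amp_zero: "coord (amp U (analysis_op \<pi> A x)) 0 = U (A x)" for x
    by (simp add: coord_amp[OF U] coord_analysis_op_zero[OF assms(1,2)])
  then show "B = U \<circ> A \<longleftrightarrow> B = cadjoint (L_op 0) \<circ> (id \<otimes>\<^sub>o\<^sub>p U) \<circ> analysis_op \<pi> A"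
    by (simp add: op_tensor_id_left[OF U] cadjoint_L_op fun_eq_iff)
  assume B_eq: "B = U \<circ> A"
  have "amp U \<in> commutant (range ltrans)"
    by (auto simp: commutant_def fun_eq_iff bounded_clinear_amp U amp_ltrans)
  then have "analysis_op \<pi> B = amp U \<circ> analysis_op \<pi> A"
    by (rule analysis_op_eq_compose[OF assms]) (simp add: B_eq amp_zero)
  from frame_projection_conj[OF assms bounded_clinear_amp[OF U] this]
  show "frame_projection \<pi> B
      = (id \<otimes>\<^sub>o\<^sub>p U) \<circ> frame_projection \<pi> A \<circ> (id \<otimes>\<^sub>o\<^sub>p cadjoint U)"
    by (simp add: op_tensor_id_left U bounded_clinear_cadjoint cadjoint_amp)
next
  show "(\<exists>U\<in>commutant (commutant (range \<pi>)). unitary U \<and> B = A \<circ> U) \<longleftrightarrow>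
      (\<exists>W\<in>\<R>. unitary W \<and> B = cadjoint (L_op 0) \<circ> (W \<otimes>\<^sub>o\<^sub>p id) \<circ> analysis_op \<pi> A)"
    using right_vN_unitary_of_bicommutant_unitary[OF assms]
      bicommutant_unitary_of_right_vN_unitary[OF assms] by blast
next
  fix W
  assume "W \<in> \<R>" and "unitary W \<and> B = cadjoint (L_op 0) \<circ> (W \<otimes>\<^sub>o\<^sub>p id) \<circ> analysis_op \<pi> A"
  then have W: "W \<in> commutant (range ltrans)"
    and B_eq: "B = cadjoint (L_op 0) \<circ> (W \<otimes>\<^sub>o\<^sub>p id) \<circ> analysis_op \<pi> A"
    by (simp_all add: right_group_vN_eq_commutant)
  have bW: "bounded_clinear W" using W by (rule commutant_bounded_clinear)
  have bW': "bounded_clinear (W \<otimes>\<^sub>o\<^sub>p (id :: 'o \<Rightarrow> 'o))"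
    by (simp add: bW bounded_clinear_op_tensor bounded_clinear_id)
  then have "W \<otimes>\<^sub>o\<^sub>p (id :: 'o \<Rightarrow> 'o) \<in> commutant (range ltrans)"
    by (auto simp: commutant_def fun_eq_iff op_tensor_ltrans bW bounded_clinear_id
        commutant_rangeD[OF W])
  then have "analysis_op \<pi> B = (W \<otimes>\<^sub>o\<^sub>p id) \<circ> analysis_op \<pi> A"
    by (rule analysis_op_eq_compose[OF assms]) (simp add: B_eq cadjoint_L_op)
  from frame_projection_conj[OF assms bW' this]
  show "frame_projection \<pi> B =
      (W \<otimes>\<^sub>o\<^sub>p id) \<circ> frame_projection \<pi> A \<circ> (cadjoint W \<otimes>\<^sub>o\<^sub>p id)"
    by (simp add: cadjoint_op_tensor_id[OF bW])
qed

end
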